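(* Suppose that the Gramians $P$ and $Q$ are positive definite and that $\sigma_r\neq\sigma_{r+1}$. Let $y$ be the output of the full system $dx(t)=Ax(t)\,dt+B\,dM(t)$, $y(t)=Cx(t)$, with $x(0)=0$, and let $y_{BT}$ be the output of the reduced order system obtained by balanced truncation, i.e. of $dx_r(t)=A_{11}x_r(t)\,dt+B_1\,dM(t)$, $y_{BT}(t)=C_1x_r(t)$, with $x_r(0)=0$. Let $P_g\in\mathbb R^{n\times r}$ be the solution of $$AP_g+P_gA_{11}^T=-B\mathcal Q_MB_1^T ,$$ and let $P_{g,2}$ denote the last $n-r$ rows of $TP_g$, where $T$ is the balancing transformation. Then, for every time horizon $\tau>0$, $$\sup_{t\in[0,\tau]}\mathbb E\,\|y(t)-y_{BT}(t)\|_{\mathbb R^p}\le\Big(\operatorname{tr}\big(\Sigma_2\,(B_2\mathcal Q_MB_2^T+2P_{g,2}A_{21}^T)\big)\Big)^{1/2}.$$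
   Context: Let $A\in\mathbb R^{n\times n}$ be asymptotically stable (all eigenvalues have negative real part), $B\in\mathbb R^{n\times m}$, $C\in\mathbb R^{p\times n}$. $M=(M_1,\dots,M_m)^T$ is an $\mathbb R^m$-valued square integrable Lévy process with mean zero (its components may be correlated), and $\mathcal Q_M=\mathbb E[M(1)M^T(1)]$ is its covariance matrix at time $1$. The stochastic differential equations are understood in the Itô sense. The reachability Gramian $P=\int_0^\infty e^{As}B\mathcal Q_MB^Te^{A^Ts}\,ds$ and the observability Gramian $Q=\int_0^\infty e^{A^Ts}C^TCe^{As}\,ds$ are the unique solutions of $AP+PA^T=-B\mathcal Q_MB^T$ and $A^TQ+QA=-C^TC$. The Hankel singular values are $\sigma_1\ge\dots\ge\sigma_n$, $\sigma_i=\sqrt{\lambda_i(PQ)}$, and $\Sigma=\operatorname{diag}(\sigma_1,\dots,\sigma_n)$. If $P,Q>0$, a balancing transformation is $T=\Sigma^{-1/2}U^TL^T$ with $T^{-1}=KV\Sigma^{-1/2}$, where $P=KK^T$, $Q=LL^T$ are square root factorisations and $K^TL=V\Sigma U^T$ is a singular value decomposition. It satisfies $TPT^T=T^{-T}QT^{-1}=\Sigma$. Fix the reduced dimension $r$ with $1\le r<n$, and partition $$TAT^{-1}=\begin{bmatrix}A_{11}&A_{12}\\ A_{21}&A_{22}\end{bmatrix},\quad TB=\begin{bmatrix}B_1\\ B_2\end{bmatrix},\quad CT^{-1}=\begin{bmatrix}C_1&C_2\end{bmatrix},\quad \Sigma=\begin{bmatrix}\Sigma_1&0\\ 0&\Sigma_2\end{bmatrix},$$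 with $A_{11}\in\mathbb R^{r\times r}$, $B_1\in\mathbb R^{r\times m}$, $C_1\in\mathbb R^{p\times r}$, $\Sigma_1=\operatorname{diag}(\sigma_1,\dots,\sigma_r)$, $\Sigma_2=\operatorname{diag}(\sigma_{r+1},\dots,\sigma_n)$. Under the hypotheses of the claim, $A_{11}$ and $A_{22}$ are asymptotically stable (a known fact). *)

theory Defs
  imports "HOL-Probability.Probability"
begin

section \<open>Matrices\<close>

definition complex_eigenvalue :: "real^'n^'n \<Rightarrow> complex \<Rightarrow> bool" where
  "complex_eigenvalue A z \<longleftrightarrow>
     (\<exists>v::complex^'n. v \<noteq> 0 \<and> (\<chi> i j. complex_of_real (A $ i $ j)) *v v = z *s v)"

definition asymptotically_stable :: "real^'n^'n \<Rightarrow> bool" where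
  "asymptotically_stable A \<longleftrightarrow> (\<forall>z. complex_eigenvalue A z \<longrightarrow> Re z < 0)"

definition positive_definite :: "real^'n^'n \<Rightarrow> bool" where
  "positive_definite A \<longleftrightarrow> transpose A = A \<and> (\<forall>x. x \<noteq> 0 \<longrightarrow> 0 < x \<bullet> (A *v x))"

text \<open>Powers are iterated matrix products: multiplication and \<open>^\<close> on the vector types
  of the library act componentwise.\<close>

definition matrix_exp :: "real^'n^'n \<Rightarrow> real^'n^'n" where
  "matrix_exp A = (\<Sum>k. (1 / fact k) *\<^sub>R ((\<lambda>X. A ** X) ^^ k) (mat 1))"

definition diag_matrix :: "('n \<Rightarrow> real) \<Rightarrow> real^'n^'n" where
  "diag_matrix d = (\<chi> i j. if i = j then d i else 0)"

text \<open>\<open>l 1 \<ge> \<dots> \<ge> l n\<close> are the eigenvalues of a real \<open>n \<times> n\<close> matrix with real spectrum, repeated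
  according to their multiplicity as roots of the characteristic polynomial.\<close>

definition ordered_eigenvalues :: "real^'n^'n \<Rightarrow> (nat \<Rightarrow> real) \<Rightarrow> bool" where
  "ordered_eigenvalues A l \<longleftrightarrow>
     antimono_on {1..CARD('n)} l \<and>
     (\<forall>x. det (mat x - A) = (\<Prod>k=1..CARD('n). x - l k))"

subsection \<open>Partitioned state space\<close>

text \<open>The state space of dimension \<open>n\<close> is \<open>real^('r + 's)\<close> with \<open>CARD('r) = r\<close> and
  \<open>CARD('s) = n - r\<close>: \<open>Inl\<close> selects the first \<open>r\<close> coordinates and \<open>Inr\<close> the last \<open>n - r\<close>.
  Index types are nonempty, so \<open>1 \<le> r < n\<close> holds, and every such pair \<open>(r, n)\<close> arises.
  The linear orders on \<open>'r\<close> and \<open>'s\<close> serve only to number the coordinates: \<open>coord_number\<close> is the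
  bijection onto \<open>{1..n}\<close> mapping the \<open>Inl\<close> part increasingly onto \<open>{1..r}\<close> and the \<open>Inr\<close> part
  increasingly onto \<open>{r+1..n}\<close>.\<close>

fun coord_number :: "'r::{finite,linorder} + 's::{finite,linorder} \<Rightarrow> nat" where
  "coord_number (Inl i) = card {..i}"
| "coord_number (Inr j) = CARD('r) + card {..j}"

definition upper_rows :: "real^'k^('r::finite + 's::finite) \<Rightarrow> real^'k^'r" where
  "upper_rows X = (\<chi> i j. X $ Inl i $ j)"

definition lower_rows :: "real^'k^('r::finite + 's::finite) \<Rightarrow> real^'k^'s" where
  "lower_rows X = (\<chi> i j. X $ Inr i $ j)"

definition left_columns :: "real^('r::finite + 's::finite)^'k \<Rightarrow> real^'r^'k" where
  "left_columns X = (\<chi> i j. X $ i $ Inl j)"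

definition right_columns :: "real^('r::finite + 's::finite)^'k \<Rightarrow> real^'s^'k" where
  "right_columns X = (\<chi> i j. X $ i $ Inr j)"

section \<open>Gramians and balancing\<close>

definition reachability_gramian ::
  "real^'n^'n \<Rightarrow> real^'m^'n \<Rightarrow> real^'m^'m \<Rightarrow> real^'n^'n" where
  "reachability_gramian A B QM =
     integral {0..} (\<lambda>s. matrix_exp (s *\<^sub>R A) ** B ** QM ** transpose B
                          ** matrix_exp (s *\<^sub>R transpose A))"

definition observability_gramian :: "real^'n^'n \<Rightarrow> real^'n^'p \<Rightarrow> real^'n^'n" where
  "observability_gramian A C =
     integral {0..} (\<lambda>s. matrix_exp (s *\<^sub>R transpose A) ** transpose C ** C
                          ** matrix_exp (s *\<^sub>R A))"

definition hankel_singular_values ::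
  "real^'n^'n \<Rightarrow> real^'n^'n \<Rightarrow> (nat \<Rightarrow> real) \<Rightarrow> bool" where
  "hankel_singular_values P Q \<sigma> \<longleftrightarrow>
     (\<exists>l. ordered_eigenvalues (P ** Q) l \<and> (\<forall>k\<in>{1..CARD('n)}. \<sigma> k = sqrt (l k)))"

definition hankel_matrix ::
  "(nat \<Rightarrow> real) \<Rightarrow> real^('r::{finite,linorder} + 's::{finite,linorder})^('r + 's)" where
  "hankel_matrix \<sigma> = diag_matrix (\<lambda>i. \<sigma> (coord_number i))"

definition balancing_transformation ::
  "real^('r::{finite,linorder} + 's::{finite,linorder})^('r + 's) \<Rightarrow> real^('r + 's)^('r + 's)
   \<Rightarrow> (nat \<Rightarrow> real) \<Rightarrow> real^('r + 's)^('r + 's) \<Rightarrow> bool" where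
  "balancing_transformation P Q \<sigma> T \<longleftrightarrow>
     (\<exists>K L U V :: real^('r + 's)^('r + 's).
        P = K ** transpose K \<and> Q = L ** transpose L \<and>
        orthogonal_matrix U \<and> orthogonal_matrix V \<and>
        transpose K ** L = V ** hankel_matrix \<sigma> ** transpose U \<and>
        T = diag_matrix (\<lambda>i. 1 / sqrt (\<sigma> (coord_number i))) ** transpose U ** transpose L)"

section \<open>Levy processes and linear equations driven by them\<close>

text \<open>Processes are indexed by \<open>real\<close>; only the times \<open>t \<ge> 0\<close> matter.\<close>

definition cadlag :: "(real \<Rightarrow> 'a::topological_space) \<Rightarrow> bool" where
  "cadlag f \<longleftrightarrow>
     (\<forall>t\<ge>0. (f \<longlongrightarrow> f t) (at_right t)) \<and> (\<forall>t>0. \<exists>l. (f \<longlongrightarrow> l) (at_left t))"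

text \<open>Stochastic continuity is not listed because it follows from stationary increments and
  right-continuity of the paths.\<close>

definition levy_process :: "'w measure \<Rightarrow> (real \<Rightarrow> 'w \<Rightarrow> 'a::euclidean_space) \<Rightarrow> bool" where
  "levy_process \<Omega> M \<longleftrightarrow>
     (\<forall>t\<ge>0. M t \<in> borel_measurable \<Omega>) \<and>
     (AE \<omega> in \<Omega>. M 0 \<omega> = 0) \<and>
     (\<forall>(t::nat \<Rightarrow> real) k. 0 \<le> t 0 \<and> mono_on {..k} t \<longrightarrow>
        prob_space.indep_vars \<Omega> (\<lambda>_. borel) (\<lambda>i \<omega>. M (t (Suc i)) \<omega> - M (t i) \<omega>) {..<k}) \<and>
     (\<forall>s\<ge>0. \<forall>h\<ge>0. distr \<Omega> borel (\<lambda>\<omega>. M (s + h) \<omega> - M s \<omega>) =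
                     distr \<Omega> borel (\<lambda>\<omega>. M h \<omega> - M 0 \<omega>)) \<and>
     (AE \<omega> in \<Omega>. cadlag (\<lambda>t. M t \<omega>))"

definition square_integrable_process ::
  "'w measure \<Rightarrow> (real \<Rightarrow> 'w \<Rightarrow> 'a::euclidean_space) \<Rightarrow> bool" where
  "square_integrable_process \<Omega> M \<longleftrightarrow> (\<forall>t\<ge>0. integrable \<Omega> (\<lambda>\<omega>. (norm (M t \<omega>))\<^sup>2))"

definition mean_zero_process ::
  "'w measure \<Rightarrow> (real \<Rightarrow> 'w \<Rightarrow> 'a::euclidean_space) \<Rightarrow> bool" where
  "mean_zero_process \<Omega> M \<longleftrightarrow> (\<forall>t\<ge>0. (\<integral>\<omega>. M t \<omega> \<partial>\<Omega>) = 0)"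

definition covariance_at_one :: "'w measure \<Rightarrow> (real \<Rightarrow> 'w \<Rightarrow> real^'m) \<Rightarrow> real^'m^'m" where
  "covariance_at_one \<Omega> M = (\<chi> i j. \<integral>\<omega>. M 1 \<omega> $ i * M 1 \<omega> $ j \<partial>\<Omega>)"

text \<open>Solutions of \<open>dx = A x dt + B dM\<close>, \<open>x(0) = 0\<close>.  As the integrand \<open>B\<close> is constant, the Ito
  integral of \<open>B\<close> with respect to \<open>M\<close> over \<open>(0, t]\<close> is \<open>B (M(t) - M(0))\<close>.  Adaptedness is not
  required: the equation determines \<open>x\<close> pathwise from \<open>M\<close> up to indistinguishability.\<close>

definition linear_sde_solution ::
  "'w measure \<Rightarrow> real^'n^'n \<Rightarrow> real^'m^'n \<Rightarrow> (real \<Rightarrow> 'w \<Rightarrow> real^'m) \<Rightarrow> (real \<Rightarrow> 'w \<Rightarrow> real^'n) \<Rightarrow> bool"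
  where
  "linear_sde_solution \<Omega> A B M x \<longleftrightarrow>
     (\<forall>t\<ge>0. x t \<in> borel_measurable \<Omega>) \<and>
     (AE \<omega> in \<Omega>. cadlag (\<lambda>t. x t \<omega>)) \<and>
     (AE \<omega> in \<Omega>. x 0 \<omega> = 0) \<and>
     (AE \<omega> in \<Omega>. \<forall>t\<ge>0.
        x t \<omega> = x 0 \<omega> + integral {0..t} (\<lambda>s. A *v x s \<omega>) + B *v (M t \<omega> - M 0 \<omega>))"

end

theory Submission
  imports Defs
begin

text \<open>
  The error system, whose output is \<open>y - yBT\<close>, has the impulse response
  \<open>F s = C e\<^bsup>sA\<^esup> B - C1 e\<^bsup>sA11\<^esup> B1\<close>.
  The bound arises in three steps: the mean square error is controlled by the energy of \<open>F\<close>, this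
  energy by the solutions of the matrix equations, and these by the discarded block.

  Stochastic part.  Pathwise, \<open>y t - yBT t\<close> is the limit of the sums
  \<open>\<Sum>\<^sub>k F (t - t\<^sub>k) (M t\<^sub>k\<^sub>+\<^sub>1 - M t\<^sub>k)\<close> over uniform grids
  (\<open>variation_of_constants_limit\<close>).  The increments of \<open>M\<close> are independent and centred, with
  covariance \<open>(t\<^sub>k\<^sub>+\<^sub>1 - t\<^sub>k) QM\<close>, so the second moment of such a sum is a Riemann sum of
  \<open>tr (F QM F\<^sup>T)\<close>.  Fatou's lemma gives
  \<open>E \<parallel>y t - yBT t\<parallel>\<^sup>2 \<le> \<integral>\<^sub>0\<^sup>t tr (F QM F\<^sup>T)\<close> (\<open>output_difference_second_moment_le\<close>), one
  half of the Ito isometry.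

  Energy part.  The integrand \<open>tr (F QM F\<^sup>T)\<close> is minus the derivative of a quadratic expression in
  \<open>e\<^bsup>sA\<^esup>\<close> and \<open>e\<^bsup>sA11\<^esup>\<close>, built from the solutions \<open>P\<close>, \<open>Pg\<close> and \<open>\<Sigma>1\<close> of the three matrix
  equations.  The part involving \<open>e\<^bsup>sA\<^esup>\<close> vanishes as \<open>s\<close> grows and the rest is nonnegative, so the
  integral is at most the value at \<open>0\<close>,
  \<open>tr (C P C\<^sup>T) + tr (C1 \<Sigma>1 C1\<^sup>T) - 2 tr (C Pg C1\<^sup>T)\<close> (\<open>output_error_energy_le\<close>).  For the
  mixed term it matters that \<open>e\<^bsup>sA11\<^esup>\<close> is bounded, which follows from the Lyapunov equation
  of \<open>\<Sigma>1\<close>.  Decay of \<open>e\<^bsup>sA\<^esup>\<close> comes from the convergence of the reachability Gramian to a positive definite matrix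
  (\<open>lyapunov_equation_of_integral\<close>): the remainder of the integral after time \<open>t\<close> is
  \<open>e\<^bsup>tA\<^esup> P (e\<^bsup>tA\<^esup>)\<^sup>T\<close>.

  Algebraic part.  In balanced coordinates both Gramians equal \<open>\<Sigma>\<close>, and comparing the blocks of the
  two Lyapunov equations turns this value into
  \<open>tr (\<Sigma>2 (B2 QM B2\<^sup>T + 2 Pg2 A21\<^sup>T))\<close> (\<open>balanced_truncation_trace_identity\<close>).
\<close>

section \<open>Matrix products and the matrix exponential\<close>

lemma bounded_bilinear_matrix_mult:
  "bounded_bilinear ((**) :: real^'n^'m \<Rightarrow> real^'k^'n \<Rightarrow> real^'k^'m)"
  unfolding bilinear_conv_bounded_bilinear[symmetric] bilinear_def
  by (auto intro!: linearI simp: vec_eq_iff matrix_matrix_mult_def sum.distrib algebra_simps sum_distrib_left)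

lemma bounded_bilinear_matrix_vector_mult:
  "bounded_bilinear ((*v) :: real^'n^'m \<Rightarrow> real^'n \<Rightarrow> real^'m)"
  unfolding bilinear_conv_bounded_bilinear[symmetric] bilinear_def
  by (auto intro!: linearI simp: vec_eq_iff matrix_vector_mult_def sum.distrib algebra_simps sum_distrib_left)

lemma bounded_linear_transpose: "bounded_linear (transpose :: real^'n^'m \<Rightarrow> real^'m^'n)"
  unfolding linear_conv_bounded_linear[symmetric]
  by (auto intro!: linearI simp: vec_eq_iff transpose_def)

lemma bounded_linear_trace: "bounded_linear (trace :: real^'n^'n \<Rightarrow> real)"
  unfolding linear_conv_bounded_linear[symmetric]
  by (auto intro!: linearI simp: trace_def sum.distrib sum_distrib_left)

lemmas matrix_mult_bilinear_simps =
  bounded_bilinear.add_left[OF bounded_bilinear_matrix_mult]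
  bounded_bilinear.add_right[OF bounded_bilinear_matrix_mult]
  bounded_bilinear.diff_left[OF bounded_bilinear_matrix_mult]
  bounded_bilinear.diff_right[OF bounded_bilinear_matrix_mult]
  bounded_bilinear.minus_left[OF bounded_bilinear_matrix_mult]
  bounded_bilinear.minus_right[OF bounded_bilinear_matrix_mult]
  bounded_bilinear.scaleR_left[OF bounded_bilinear_matrix_mult]
  bounded_bilinear.scaleR_right[OF bounded_bilinear_matrix_mult]
  bounded_bilinear.zero_left[OF bounded_bilinear_matrix_mult]
  bounded_bilinear.zero_right[OF bounded_bilinear_matrix_mult]

lemma has_vector_derivative_vec:
  fixes f :: "real \<Rightarrow> 'a::euclidean_space^'n"
  assumes "\<And>i. ((\<lambda>t. f t $ i) has_vector_derivative f' $ i) (at t)"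
  shows "(f has_vector_derivative f') (at t)"
  unfolding has_vector_derivative_def has_derivative_at
proof
  have "((\<lambda>h. (f (t + h) - f t - h *\<^sub>R f') /\<^sub>R norm h) \<longlongrightarrow> 0) (at 0)"
  proof (rule vec_tendstoI)
    fix i
    have "((\<lambda>h. norm ((f (t + h) $ i - f t $ i - h *\<^sub>R f' $ i) /\<^sub>R norm h)) \<longlongrightarrow> 0) (at 0)"
      using assms[of i] unfolding has_vector_derivative_def has_derivative_at
      by (simp add: divide_inverse mult.commute)
    then have "((\<lambda>h. (f (t + h) $ i - f t $ i - h *\<^sub>R f' $ i) /\<^sub>R norm h) \<longlongrightarrow> 0) (at 0)"
      by (rule tendsto_norm_zero_cancel)
    then show "((\<lambda>h. ((f (t + h) - f t - h *\<^sub>R f') /\<^sub>R norm h) $ i) \<longlongrightarrow> 0 $ i) (at 0)"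
      by simp
  qed
  from tendsto_norm_zero[OF this]
  show "((\<lambda>h. norm (f (t + h) - f t - h *\<^sub>R f') / norm h) \<longlongrightarrow> 0) (at 0)"
    by (simp add: divide_inverse mult.commute)
qed (rule bounded_linear_scaleR_left)

text \<open>Iterated products, because \<open>^\<close> on matrices is the componentwise power.\<close>

abbreviation matrix_power :: "real^'n^'n \<Rightarrow> nat \<Rightarrow> real^'n^'n" where
  "matrix_power A k \<equiv> ((\<lambda>X. A ** X) ^^ k) (mat 1)"

lemma matrix_power_Suc_right: "matrix_power A (Suc k) = matrix_power A k ** A"
  by (induction k) (simp_all add: matrix_mul_assoc)

lemma matrix_power_scaleR: "matrix_power (c *\<^sub>R A) k = c ^ k *\<^sub>R matrix_power A k"
  by (induction k) (simp_all add: matrix_mult_bilinear_simps mult.commute)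

lemma transpose_matrix_power: "transpose (matrix_power A k) = matrix_power (transpose A) k"
proof (induction k)
  case (Suc k)
  have "transpose (matrix_power A (Suc k)) = transpose (matrix_power A k) ** transpose A"
    by (simp add: matrix_transpose_mul)
  also have "\<dots> = matrix_power (transpose A) (Suc k)"
    by (simp only: Suc matrix_power_Suc_right)
  finally show ?case .
qed simp

lemma norm_matrix_power_le:
  fixes A :: "real^'n^'n"
  shows "\<exists>c\<ge>0. \<forall>k. norm (matrix_power A k) \<le> c ^ k * norm (mat 1 :: real^'n^'n)"
proof -
  obtain K where K: "K > 0" "\<And>(X :: real^'n^'n) (Y :: real^'n^'n). norm (X ** Y) \<le> norm X * norm Y * K"
    using bounded_bilinear.pos_bounded[OF bounded_bilinear_matrix_mult] by auto
  define c where "c = norm A * K"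
  have "norm (matrix_power A k) \<le> c ^ k * norm (mat 1 :: real^'n^'n)" for k
  proof (induction k)
    case (Suc k)
    have "norm (matrix_power A (Suc k)) \<le> c * norm (matrix_power A k)"
      using K(2)[of A "matrix_power A k"] by (simp add: c_def mult_ac)
    also have "\<dots> \<le> c * (c ^ k * norm (mat 1 :: real^'n^'n))"
      using K(1) by (intro mult_left_mono Suc) (simp add: c_def)
    finally show ?case by (simp add: mult_ac)
  qed simp
  moreover have "c \<ge> 0" using K(1) by (simp add: c_def)
  ultimately show ?thesis by blast
qed

lemma matrix_exp_sums:
  fixes A :: "real^'n^'n"
  shows "(\<lambda>k. (t ^ k / fact k) *\<^sub>R matrix_power A k) sums matrix_exp (t *\<^sub>R A)"
proof -
  obtain c where c: "c \<ge> 0" "\<And>k. norm (matrix_power A k) \<le> c ^ k * norm (mat 1 :: real^'n^'n)"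
    using norm_matrix_power_le[of A] by blast
  have "summable (\<lambda>k. (t ^ k / fact k) *\<^sub>R matrix_power A k)"
  proof (rule summable_comparison_test)
    show "\<exists>N. \<forall>k\<ge>N. norm ((t ^ k / fact k) *\<^sub>R matrix_power A k)
          \<le> inverse (fact k) * (\<bar>t\<bar> * c) ^ k * norm (mat 1 :: real^'n^'n)"
    proof (intro exI allI impI)
      fix k :: nat
      have "norm ((t ^ k / fact k) *\<^sub>R matrix_power A k) = (\<bar>t\<bar> ^ k / fact k) * norm (matrix_power A k)"
        by (simp add: power_abs)
      also have "\<dots> \<le> (\<bar>t\<bar> ^ k / fact k) * (c ^ k * norm (mat 1 :: real^'n^'n))"
        by (intro mult_left_mono c) auto
      finally show "norm ((t ^ k / fact k) *\<^sub>R matrix_power A k)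
          \<le> inverse (fact k) * (\<bar>t\<bar> * c) ^ k * norm (mat 1 :: real^'n^'n)"
        by (simp add: power_mult_distrib divide_inverse mult_ac)
    qed
    show "summable (\<lambda>k. inverse (fact k) * (\<bar>t\<bar> * c) ^ k * norm (mat 1 :: real^'n^'n))"
      by (intro summable_mult2 summable_exp)
  qed
  then have "(\<lambda>k. (t ^ k / fact k) *\<^sub>R matrix_power A k) sums
      (\<Sum>k. (t ^ k / fact k) *\<^sub>R matrix_power A k)" by (rule summable_sums)
  then show ?thesis
    by (simp add: matrix_exp_def matrix_power_scaleR)
qed

lemma matrix_exp_0: "matrix_exp 0 = (mat 1 :: real^'n^'n)"
proof -
  have "(\<lambda>k. (0 ^ k / fact k) *\<^sub>R matrix_power (0::real^'n^'n) k) sums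
      (\<Sum>k\<in>{0}. (0 ^ k / fact k) *\<^sub>R matrix_power (0::real^'n^'n) k)"
    by (rule sums_finite) auto
  from sums_unique2[OF this matrix_exp_sums[of 0 0]] show ?thesis by simp
qed

lemma transpose_matrix_exp: "transpose (matrix_exp (t *\<^sub>R A)) = matrix_exp (t *\<^sub>R transpose A)"
proof -
  have "(\<lambda>k. transpose ((t ^ k / fact k) *\<^sub>R matrix_power A k)) sums transpose (matrix_exp (t *\<^sub>R A))"
    by (rule bounded_linear.sums[OF bounded_linear_transpose matrix_exp_sums])
  moreover have "(\<lambda>k. transpose ((t ^ k / fact k) *\<^sub>R matrix_power A k))
      = (\<lambda>k. (t ^ k / fact k) *\<^sub>R matrix_power (transpose A) k)"
    by (simp only: bounded_linear.linear[OF bounded_linear_transpose, THEN linear_cmul] transpose_matrix_power)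
  ultimately have "(\<lambda>k. (t ^ k / fact k) *\<^sub>R matrix_power (transpose A) k) sums transpose (matrix_exp (t *\<^sub>R A))"
    by simp
  from sums_unique2[OF this matrix_exp_sums] show ?thesis .
qed

text \<open>Every entry of the exponential is a real power series in \<open>t\<close>, so it may be differentiated termwise.\<close>

lemma matrix_exp_deriv_left:
  fixes A :: "real^'n^'n"
  shows "((\<lambda>t. matrix_exp (t *\<^sub>R A)) has_vector_derivative A ** matrix_exp (t *\<^sub>R A)) (at t)"
proof (intro has_vector_derivative_vec)
  fix i j
  define c where "c k = matrix_power A k $ i $ j / fact k" for k
  have entry: "bounded_linear (\<lambda>X::real^'n^'n. X $ i $ j)"
    using bounded_linear_compose[OF bounded_linear_vec_nth bounded_linear_vec_nth] by blast
  have sums: "(\<lambda>k. c k * s ^ k) sums (matrix_exp (s *\<^sub>R A) $ i $ j)" for s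
    using bounded_linear.sums[OF entry matrix_exp_sums[of s A]] by (simp add: c_def mult_ac)
  have sums': "(\<lambda>k. diffs c k * s ^ k) sums ((A ** matrix_exp (s *\<^sub>R A)) $ i $ j)" for s
  proof -
    have "(\<lambda>k. A ** ((s ^ k / fact k) *\<^sub>R matrix_power A k)) sums (A ** matrix_exp (s *\<^sub>R A))"
      by (rule bounded_linear.sums[OF bounded_bilinear.bounded_linear_right[OF bounded_bilinear_matrix_mult] matrix_exp_sums])
    from bounded_linear.sums[OF entry this] show ?thesis
      by (simp add: diffs_def c_def matrix_mult_bilinear_simps field_simps del: of_nat_Suc)
  qed
  have "((\<lambda>s. \<Sum>k. c k * s ^ k) has_real_derivative (\<Sum>k. diffs c k * t ^ k)) (at t)"
    by (rule termdiffs_strong_converges_everywhere) (use sums in \<open>auto simp: summable_def\<close>)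
  then show "((\<lambda>t. matrix_exp (t *\<^sub>R A) $ i $ j) has_vector_derivative (A ** matrix_exp (t *\<^sub>R A)) $ i $ j) (at t)"
    using sums sums' by (simp add: sums_iff has_real_derivative_iff_has_vector_derivative)
qed

lemma matrix_exp_commute: "A ** matrix_exp (t *\<^sub>R A) = matrix_exp (t *\<^sub>R A) ** A"
proof -
  have "(\<lambda>k. A ** ((t ^ k / fact k) *\<^sub>R matrix_power A k)) sums (A ** matrix_exp (t *\<^sub>R A))"
    by (rule bounded_linear.sums[OF bounded_bilinear.bounded_linear_right[OF bounded_bilinear_matrix_mult] matrix_exp_sums])
  moreover have "(\<lambda>k. ((t ^ k / fact k) *\<^sub>R matrix_power A k) ** A) sums (matrix_exp (t *\<^sub>R A) ** A)"
    by (rule bounded_linear.sums[OF bounded_bilinear.bounded_linear_left[OF bounded_bilinear_matrix_mult] matrix_exp_sums])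
  moreover have "A ** matrix_power A k = matrix_power A k ** A" for k
    using matrix_power_Suc_right[of k A] by simp
  ultimately show ?thesis
    by (simp add: matrix_mult_bilinear_simps sums_unique2)
qed

text \<open>The source of every Lyapunov and Sylvester argument below: if \<open>A X + X D\<^sup>T = - W\<close>, then
  \<open>e\<^bsup>tA\<^esup> X (e\<^bsup>tD\<^esup>)\<^sup>T\<close> is a primitive of \<open>- e\<^bsup>tA\<^esup> W (e\<^bsup>tD\<^esup>)\<^sup>T\<close>.\<close>

lemma matrix_exp_sandwich_deriv:
  fixes A :: "real^'n^'n" and D :: "real^'k^'k" and X :: "real^'k^'n"
  shows "((\<lambda>t. matrix_exp (t *\<^sub>R A) ** X ** transpose (matrix_exp (t *\<^sub>R D)))
     has_vector_derivative
       matrix_exp (t *\<^sub>R A) ** (A ** X + X ** transpose D) ** transpose (matrix_exp (t *\<^sub>R D))) (at t)"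
proof -
  have 1: "((\<lambda>t. matrix_exp (t *\<^sub>R A) ** X) has_vector_derivative A ** matrix_exp (t *\<^sub>R A) ** X) (at t)"
    by (rule bounded_linear.has_vector_derivative[OF bounded_bilinear.bounded_linear_left[OF bounded_bilinear_matrix_mult] matrix_exp_deriv_left])
  have 2: "((\<lambda>t. transpose (matrix_exp (t *\<^sub>R D))) has_vector_derivative transpose (D ** matrix_exp (t *\<^sub>R D))) (at t)"
    by (rule bounded_linear.has_vector_derivative[OF bounded_linear_transpose matrix_exp_deriv_left])
  define E where "E = matrix_exp (t *\<^sub>R A)"
  define F where "F = matrix_exp (t *\<^sub>R D)"
  have "A ** E = E ** A" "D ** F = F ** D"
    by (simp_all add: E_def F_def matrix_exp_commute)
  then have "E ** X ** transpose (D ** F) + A ** E ** X ** transpose F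
      = E ** (A ** X + X ** transpose D) ** transpose F"
    by (simp add: matrix_transpose_mul matrix_mul_assoc matrix_mult_bilinear_simps)
  then show ?thesis
    using bounded_bilinear.has_vector_derivative[OF bounded_bilinear_matrix_mult 1 2]
    by (simp add: E_def F_def)
qed

lemma matrix_exp_sandwich_deriv_outside:
  fixes A :: "real^'n^'n" and D :: "real^'k^'k" and X :: "real^'k^'n"
  defines "G \<equiv> \<lambda>t. matrix_exp (t *\<^sub>R A) ** X ** transpose (matrix_exp (t *\<^sub>R D))"
  shows "(G has_vector_derivative A ** G t + G t ** transpose D) (at t)"
proof -
  define E where "E = matrix_exp (t *\<^sub>R A)"
  define F where "F = matrix_exp (t *\<^sub>R D)"
  have E: "A ** E = E ** A" and F: "D ** F = F ** D"
    by (simp_all add: E_def F_def matrix_exp_commute)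
  have "transpose D ** transpose F = transpose F ** transpose D"
    by (metis F matrix_transpose_mul)
  then have "X ** transpose F ** transpose D = X ** transpose D ** transpose F"
    by (simp flip: matrix_mul_assoc)
  then have "E ** (X ** transpose F ** transpose D) = E ** (X ** transpose D ** transpose F)"
    by simp
  with E have "E ** (A ** X + X ** transpose D) ** transpose F
      = A ** (E ** X ** transpose F) + E ** X ** transpose F ** transpose D"
    by (simp add: matrix_mul_assoc matrix_mult_bilinear_simps)
  then show ?thesis
    using matrix_exp_sandwich_deriv[of A X D t] by (simp add: G_def E_def F_def)
qed

section \<open>Lyapunov equations\<close>

lemma has_integral_halfline_tendsto:
  fixes f :: "real \<Rightarrow> 'a::banach"
  assumes "(f has_integral I) {0..}"
  shows "((\<lambda>t. integral {0..t} f) \<longlongrightarrow> I) at_top"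
proof (rule tendstoI)
  fix e :: real assume "e > 0"
  with assms obtain b where b: "b > 0"
    "\<And>u v. ball 0 b \<subseteq> cbox u v \<Longrightarrow> norm (integral (cbox u v) (\<lambda>x. if x \<in> {0..} then f x else 0) - I) < e"
    unfolding has_integral_alt' by blast
  show "\<forall>\<^sub>F t in at_top. dist (integral {0..t} f) I < e"
    using eventually_ge_at_top[of b]
  proof eventually_elim
    case (elim t)
    have "ball 0 b \<subseteq> cbox (-t) t" using elim by (auto simp: dist_real_def)
    from b(2)[OF this] have "norm (integral {-t..t} (\<lambda>x. if x \<in> {0..} then f x else 0) - I) < e" by simp
    moreover have "integral {-t..t} (\<lambda>x. if x \<in> {0..} then f x else 0) = integral ({-t..t} \<inter> {0..}) f"
      by (subst Int_commute) (rule integral_restrict_Int)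
    moreover have "{-t..t} \<inter> {0..} = {0..t}" using elim b(1) by auto
    ultimately show ?case by (simp only: dist_norm)
  qed
qed

text \<open>The integral over \<open>{t..t + 1}\<close> tends to \<open>0\<close> because the improper integral converges, and to \<open>L\<close>
  because the integrand does.\<close>

lemma limit_zero_of_integrable_halfline:
  fixes f :: "real \<Rightarrow> 'a::banach"
  assumes f: "(f has_integral I) {0..}" and cont: "continuous_on {0..} f"
    and lim: "(f \<longlongrightarrow> L) at_top"
  shows "L = 0"
proof -
  let ?H = "\<lambda>t. integral {0..t} f"
  have H: "(?H \<longlongrightarrow> I) at_top" by (rule has_integral_halfline_tendsto[OF f])
  have "((\<lambda>t. ?H (t + 1)) \<longlongrightarrow> I) at_top"
    by (rule filterlim_compose[OF H]) (intro filterlim_tendsto_add_at_top[of _ 1 _ "\<lambda>x. x", simplified add.commute] tendsto_const filterlim_ident)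
  from tendsto_diff[OF this H] have "((\<lambda>t. ?H (t + 1) - ?H t) \<longlongrightarrow> 0) at_top" by simp
  moreover have "((\<lambda>t. ?H (t + 1) - ?H t) \<longlongrightarrow> L) at_top"
  proof (rule tendstoI)
    fix e :: real assume e: "e > 0"
    then have "\<forall>\<^sub>F t in at_top. dist (f t) L < e/2"
      using lim by (intro tendstoD) auto
    then obtain N where N: "\<And>t. t \<ge> N \<Longrightarrow> dist (f t) L < e/2"
      by (auto simp: eventually_at_top_linorder)
    show "\<forall>\<^sub>F t in at_top. dist (?H (t + 1) - ?H t) L < e"
      using eventually_ge_at_top[of "max 0 N"]
    proof eventually_elim
      case (elim t)
      have int: "f integrable_on {a..b}" if "a \<ge> 0" for a b
        using that by (intro integrable_continuous_real continuous_on_subset[OF cont]) auto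
      have "?H t + integral {t..t+1} f = ?H (t + 1)"
        using elim by (intro Henstock_Kurzweil_Integration.integral_combine int) auto
      then have "?H (t + 1) - ?H t - L = integral {t..t+1} (\<lambda>s. f s - L)"
        using elim by (subst Henstock_Kurzweil_Integration.integral_diff) (auto intro: int simp: algebra_simps)
      also have "norm \<dots> \<le> (e/2) * (t + 1 - t)"
        using elim N by (intro integral_bound continuous_intros continuous_on_subset[OF cont])
          (auto simp: dist_norm intro: less_imp_le)
      finally show ?case using e by (simp add: dist_norm)
    qed
  qed
  ultimately show "L = 0"
    using tendsto_unique trivial_limit_at_top_linorder by blast
qed

lemma has_vector_derivative_imp_continuous_on:
  assumes "\<And>t. (f has_vector_derivative f' t) (at t)"
  shows "continuous_on S f"
  using assms by (meson continuous_at_imp_continuous_on has_vector_derivative_continuous)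

text \<open>Integrating \<open>G' = A G + G A\<^sup>T\<close> shows that \<open>G t\<close> converges to \<open>W + A P + P A\<^sup>T\<close>; as \<open>G\<close> is integrable,
  this limit is \<open>0\<close>.  The equation so obtained identifies \<open>e\<^bsup>tA\<^esup> P (e\<^bsup>tA\<^esup>)\<^sup>T\<close> as the remainder of the
  integral after time \<open>t\<close>.\<close>

lemma lyapunov_equation_of_integral:
  fixes A W P :: "real^'n^'n"
  defines "G \<equiv> \<lambda>t. matrix_exp (t *\<^sub>R A) ** W ** transpose (matrix_exp (t *\<^sub>R A))"
  assumes P: "(G has_integral P) {0..}"
  shows "A ** P + P ** transpose A = - W"
    and "((\<lambda>t. matrix_exp (t *\<^sub>R A) ** P ** transpose (matrix_exp (t *\<^sub>R A))) \<longlongrightarrow> 0) at_top"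
proof -
  define H where "H t = integral {0..t} G" for t
  note lin = bounded_bilinear.bounded_linear_right[OF bounded_bilinear_matrix_mult, of A]
    bounded_bilinear.bounded_linear_left[OF bounded_bilinear_matrix_mult, of "transpose A"]
  have deriv: "(G has_vector_derivative A ** G t + G t ** transpose A) (at t)" for t
    unfolding G_def by (rule matrix_exp_sandwich_deriv_outside)
  have cont: "continuous_on S G" for S
    by (rule has_vector_derivative_imp_continuous_on[OF deriv])
  have GH: "(G has_integral H t) {0..t}" for t
    unfolding H_def by (intro integrable_integral integrable_continuous_real cont)
  have H: "(H \<longlongrightarrow> P) at_top"
    unfolding H_def by (rule has_integral_halfline_tendsto[OF P])
  have G_eq: "G t = W + (A ** H t + H t ** transpose A)" if "t \<ge> 0" for t
  proof -
    have "((\<lambda>s. A ** G s + G s ** transpose A) has_integral G t - G 0) {0..t}"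
      by (rule fundamental_theorem_of_calculus[OF that])
         (rule has_vector_derivative_at_within[OF deriv])
    moreover have "((\<lambda>s. A ** G s + G s ** transpose A) has_integral A ** H t + H t ** transpose A) {0..t}"
      by (intro has_integral_add has_integral_linear[OF GH lin(1), unfolded o_def]
          has_integral_linear[OF GH lin(2), unfolded o_def])
    ultimately have "G t - G 0 = A ** H t + H t ** transpose A"
      by (rule has_integral_unique)
    moreover have "G 0 = W" by (simp add: G_def matrix_exp_0 transpose_mat)
    ultimately show ?thesis by (simp add: algebra_simps)
  qed
  have "((\<lambda>t. W + (A ** H t + H t ** transpose A)) \<longlongrightarrow> W + (A ** P + P ** transpose A)) at_top"
    by (intro tendsto_intros bounded_linear.tendsto[OF lin(1)] bounded_linear.tendsto[OF lin(2)] H)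
  then have "(G \<longlongrightarrow> W + (A ** P + P ** transpose A)) at_top"
    by (rule Lim_transform_eventually)
       (use eventually_ge_at_top[of 0] in eventually_elim, simp add: G_eq)
  from limit_zero_of_integrable_halfline[OF P cont this]
  show lyap: "A ** P + P ** transpose A = - W"
    by (simp add: add_eq_0_iff)
  \<comment> \<open>the remainder of the integral after time \<open>t\<close>\<close>
  define R where "R t = matrix_exp (t *\<^sub>R A) ** P ** transpose (matrix_exp (t *\<^sub>R A))" for t
  have R_eq: "R t = P - H t" if "t \<ge> 0" for t
  proof -
    have "((\<lambda>s. - G s) has_integral R t - R 0) {0..t}"
    proof (rule fundamental_theorem_of_calculus[OF that])
      fix s
      have "(R has_vector_derivative - G s) (at s)"
        using matrix_exp_sandwich_deriv[of A P A s] lyap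
        by (simp add: R_def[abs_def] G_def matrix_mult_bilinear_simps)
      then show "(R has_vector_derivative - G s) (at s within {0..t})"
        by (rule has_vector_derivative_at_within)
    qed
    moreover have "((\<lambda>s. - G s) has_integral - H t) {0..t}"
      by (intro has_integral_neg GH)
    ultimately have "R t - R 0 = - H t" by (rule has_integral_unique)
    moreover have "R 0 = P" by (simp add: R_def matrix_exp_0 transpose_mat)
    ultimately show ?thesis by (simp add: algebra_simps)
  qed
  have "\<forall>\<^sub>F t in at_top. P - H t = R t"
    using eventually_ge_at_top[of 0] by eventually_elim (simp add: R_eq)
  moreover have "((\<lambda>t. P - H t) \<longlongrightarrow> 0) at_top"
    using tendsto_diff[OF tendsto_const H, of P] by simp
  ultimately show "((\<lambda>t. matrix_exp (t *\<^sub>R A) ** P ** transpose (matrix_exp (t *\<^sub>R A))) \<longlongrightarrow> 0) at_top"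
    unfolding R_def[symmetric] by (rule Lim_transform_eventually[rotated])
qed

text \<open>The constant is the minimum of the quadratic form on the unit sphere.\<close>

lemma positive_definite_coercive:
  fixes P :: "real^'n^'n"
  assumes "\<And>x. x \<noteq> 0 \<Longrightarrow> 0 < x \<bullet> (P *v x)"
  obtains c where "c > 0" "\<And>x. c * (norm x)\<^sup>2 \<le> x \<bullet> (P *v x)"
proof -
  let ?S = "sphere (0::real^'n) 1"
  have "axis undefined 1 \<in> ?S" by (simp add: norm_axis_1)
  then have "?S \<noteq> {}" by blast
  moreover have "continuous_on ?S (\<lambda>x. x \<bullet> (P *v x))"
    by (intro continuous_intros linear_continuous_on matrix_vector_mul_bounded_linear)
  ultimately obtain u where u: "u \<in> ?S" "\<And>x. x \<in> ?S \<Longrightarrow> u \<bullet> (P *v u) \<le> x \<bullet> (P *v x)"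
    using continuous_attains_inf[OF compact_sphere] by blast
  let ?c = "u \<bullet> (P *v u)"
  have "?c * (norm x)\<^sup>2 \<le> x \<bullet> (P *v x)" for x
  proof (cases "x = 0")
    case False
    then have "?c \<le> (x /\<^sub>R norm x) \<bullet> (P *v (x /\<^sub>R norm x))"
      by (intro u(2)) simp
    also have "\<dots> = (x \<bullet> (P *v x)) / (norm x)\<^sup>2"
      by (simp add: matrix_vector_mult_scaleR power2_eq_square divide_inverse)
    finally show ?thesis using False by (simp add: field_simps)
  qed simp
  moreover have "?c > 0" using u(1) by (intro assms) auto
  ultimately show thesis using that by blast
qed

lemma congruence_diag_entry:
  fixes X :: "real^'n^'m" and P :: "real^'n^'n"
  shows "(X ** P ** transpose X) $ i $ i = X $ i \<bullet> (P *v (X $ i))"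
  by (simp add: matrix_matrix_mult_def matrix_vector_mult_def transpose_def inner_vec_def
      sum_distrib_left sum_distrib_right mult_ac) (subst sum.swap, simp add: mult_ac)

lemma trace_congruence:
  fixes X :: "real^'n^'m" and P :: "real^'n^'n"
  shows "trace (X ** P ** transpose X) = (\<Sum>i\<in>UNIV. X $ i \<bullet> (P *v (X $ i)))"
  by (simp add: trace_def congruence_diag_entry)

text \<open>The diagonal entries of \<open>X P X\<^sup>T\<close> are the values of the quadratic form of \<open>P\<close> at the rows of \<open>X\<close>, so
  they control the norms of these rows.\<close>

lemma tendsto_zero_of_congruence:
  fixes X :: "'b \<Rightarrow> real^'n^'m" and P :: "real^'n^'n"
  assumes P: "\<And>x. x \<noteq> 0 \<Longrightarrow> 0 < x \<bullet> (P *v x)"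
    and lim: "((\<lambda>t. X t ** P ** transpose (X t)) \<longlongrightarrow> 0) F"
  shows "(X \<longlongrightarrow> 0) F"
proof (rule vec_tendstoI)
  fix i
  obtain c where c: "c > 0" "\<And>x. c * (norm x)\<^sup>2 \<le> x \<bullet> (P *v x)"
    using positive_definite_coercive[OF P] by blast
  have "((\<lambda>t. (X t ** P ** transpose (X t)) $ i $ i) \<longlongrightarrow> 0) F"
    using tendsto_vec_nth[OF tendsto_vec_nth[OF lim]] by simp
  then have lim': "((\<lambda>t. (X t ** P ** transpose (X t)) $ i $ i / c) \<longlongrightarrow> 0) F"
    by (rule tendsto_divide_zero)
  have "((\<lambda>t. (norm (X t $ i))\<^sup>2) \<longlongrightarrow> 0) F"
  proof (rule tendsto_sandwich[OF _ _ tendsto_const lim'])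
    show "\<forall>\<^sub>F t in F. (norm (X t $ i))\<^sup>2 \<le> (X t ** P ** transpose (X t)) $ i $ i / c"
      using c by (auto simp: congruence_diag_entry field_simps intro!: always_eventually)
  qed simp
  from tendsto_real_sqrt[OF this] have "((\<lambda>t. norm (X t $ i)) \<longlongrightarrow> 0) F" by simp
  then show "((\<lambda>t. X t $ i) \<longlongrightarrow> 0 $ i) F"
    by (simp add: tendsto_norm_zero_iff)
qed

text \<open>The diagonal entries of \<open>e\<^bsup>tD\<^esup> S (e\<^bsup>tD\<^esup>)\<^sup>T\<close> are nonincreasing in \<open>t\<close> and control the rows of
  \<open>e\<^bsup>tD\<^esup>\<close>.  Decay cannot be expected, as \<open>W\<close> is only semidefinite.\<close>

lemma matrix_exp_bounded_of_lyapunov: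
  fixes D S W :: "real^'n^'n"
  assumes S: "\<And>x. x \<noteq> 0 \<Longrightarrow> 0 < x \<bullet> (S *v x)"
    and W: "\<And>x. 0 \<le> x \<bullet> (W *v x)"
    and lyap: "D ** S + S ** transpose D = - W"
  obtains K where "\<And>t. t \<ge> 0 \<Longrightarrow> norm (matrix_exp (t *\<^sub>R D)) \<le> K"
proof -
  define E where "E t = matrix_exp (t *\<^sub>R D)" for t
  obtain c where c: "c > 0" "\<And>x. c * (norm x)\<^sup>2 \<le> x \<bullet> (S *v x)"
    using positive_definite_coercive[OF S] by blast
  have row: "norm (E t $ i) \<le> sqrt (S $ i $ i / c)" if "t \<ge> 0" for t i
  proof -
    have "(E t ** S ** transpose (E t)) $ i $ i \<le> (E 0 ** S ** transpose (E 0)) $ i $ i"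
    proof (rule DERIV_nonpos_imp_nonincreasing[OF that])
      fix s
      have "((\<lambda>t. E t ** S ** transpose (E t)) has_vector_derivative
            - (E s ** W ** transpose (E s))) (at s)"
        using matrix_exp_sandwich_deriv[of D S D s] lyap
        by (simp add: E_def[abs_def] matrix_mult_bilinear_simps)
      from bounded_linear.has_vector_derivative[OF bounded_linear_vec_nth
            bounded_linear.has_vector_derivative[OF bounded_linear_vec_nth this]]
      have "((\<lambda>t. (E t ** S ** transpose (E t)) $ i $ i) has_real_derivative
            - ((E s ** W ** transpose (E s)) $ i $ i)) (at s)"
        by (simp add: has_real_derivative_iff_has_vector_derivative)
      moreover have "- ((E s ** W ** transpose (E s)) $ i $ i) \<le> 0"
        using W by (simp add: congruence_diag_entry)
      ultimately show "\<exists>y. ((\<lambda>t. (E t ** S ** transpose (E t)) $ i $ i) has_real_derivative y) (at s) \<and> y \<le> 0"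
        by blast
    qed
    then have "c * (norm (E t $ i))\<^sup>2 \<le> S $ i $ i"
      using c(2)[of "E t $ i"] by (simp add: congruence_diag_entry[symmetric]) (simp add: E_def matrix_exp_0 transpose_mat)
    then have "(norm (E t $ i))\<^sup>2 \<le> S $ i $ i / c" using c(1) by (simp add: field_simps)
    then show ?thesis by (rule real_le_rsqrt)
  qed
  have "norm (E t) \<le> (\<Sum>i\<in>UNIV. sqrt (S $ i $ i / c))" if "t \<ge> 0" for t
  proof -
    have "norm (E t) \<le> (\<Sum>i\<in>UNIV. norm (E t $ i))"
      unfolding norm_vec_def[of "E t"] by (rule L2_set_le_sum) simp
    also have "\<dots> \<le> (\<Sum>i\<in>UNIV. sqrt (S $ i $ i / c))" by (intro sum_mono row that)
    finally show ?thesis .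
  qed
  then show thesis using that unfolding E_def by blast
qed

section \<open>The energy of the error impulse response\<close>

lemma trace_transpose: "trace (transpose X) = trace (X :: real^'n^'n)"
  by (simp add: trace_def transpose_def)

lemma inner_congruence:
  fixes B :: "real^'m^'n" and QM :: "real^'m^'m"
  shows "x \<bullet> ((B ** QM ** transpose B) *v x) = (transpose B *v x) \<bullet> (QM *v (transpose B *v x))"
  by (metis dot_lmul_matrix matrix_vector_mul_assoc transpose_matrix_vector)

lemma transpose_diff: "transpose (X - Y) = transpose X - transpose (Y :: real^'n^'m)"
  by (simp add: transpose_def vec_eq_iff)

text \<open>With \<open>a\<close>, \<open>b\<close> and \<open>c\<close> as in the proof, \<open>a + b - 2 c\<close> is a primitive of \<open>- tr (F QM F\<^sup>T)\<close>, whose value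
  at \<open>0\<close> is the right-hand side.  The integral up to \<open>t\<close> is at most the integral up to any later \<open>T\<close>; as
  \<open>T\<close> grows, \<open>a T\<close> and \<open>c T\<close> vanish, while \<open>b T \<ge> 0\<close> may be dropped.  The mixed term \<open>c\<close> vanishes
  because \<open>e\<^bsup>tD\<^esup>\<close> stays bounded while \<open>e\<^bsup>tA\<^esup>\<close> decays.\<close>

lemma output_error_energy_le:
  fixes A P :: "real^'n^'n" and D S :: "real^'k^'k" and Pg :: "real^'k^'n"
    and B :: "real^'m^'n" and B1 :: "real^'m^'k" and C :: "real^'n^'p" and C1 :: "real^'k^'p"
    and QM :: "real^'m^'m"
  defines "F \<equiv> \<lambda>s. C ** matrix_exp (s *\<^sub>R A) ** B - C1 ** matrix_exp (s *\<^sub>R D) ** B1"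
  assumes sym: "transpose QM = QM" and psd: "\<And>v. 0 \<le> v \<bullet> (QM *v v)"
    and eqP: "A ** P + P ** transpose A = - (B ** QM ** transpose B)"
    and eqPg: "A ** Pg + Pg ** transpose D = - (B ** QM ** transpose B1)"
    and eqS: "D ** S + S ** transpose D = - (B1 ** QM ** transpose B1)"
    and S: "\<And>x. x \<noteq> 0 \<Longrightarrow> 0 < x \<bullet> (S *v x)"
    and stable: "((\<lambda>t. matrix_exp (t *\<^sub>R A)) \<longlongrightarrow> 0) at_top"
    and t: "t \<ge> 0"
  shows "integral {0..t} (\<lambda>s. trace (F s ** QM ** transpose (F s)))
    \<le> trace (C ** P ** transpose C) + trace (C1 ** S ** transpose C1) - 2 * trace (C ** Pg ** transpose C1)"
    (is "integral _ ?\<phi> \<le> ?K")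
proof -
  define E where "E t = matrix_exp (t *\<^sub>R A)" for t
  define E1 where "E1 t = matrix_exp (t *\<^sub>R D)" for t
  define a where "a t = trace (C ** (E t ** P ** transpose (E t)) ** transpose C)" for t
  define b where "b t = trace (C1 ** (E1 t ** S ** transpose (E1 t)) ** transpose C1)" for t
  define c where "c t = trace (C ** (E t ** Pg ** transpose (E1 t)) ** transpose C1)" for t
  have lin: "bounded_linear (\<lambda>X. trace (Y ** X ** Z))"
    for Y :: "real^'i^'q" and Z :: "real^'q^'j"
    by (intro bounded_linear_compose[OF bounded_linear_trace]
        bounded_linear_compose[OF bounded_bilinear.bounded_linear_left[OF bounded_bilinear_matrix_mult]]
        bounded_bilinear.bounded_linear_right[OF bounded_bilinear_matrix_mult])
  have a': "(a has_vector_derivative - trace ((C ** E s ** B) ** QM ** transpose (C ** E s ** B))) (at s)" for s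
    using bounded_linear.has_vector_derivative[OF lin[of C "transpose C"] matrix_exp_sandwich_deriv[of A P A s]]
    by (simp add: a_def[abs_def] E_def eqP matrix_mult_bilinear_simps matrix_transpose_mul matrix_mul_assoc
        linear_neg[OF bounded_linear.linear[OF bounded_linear_trace]])
  have b': "(b has_vector_derivative - trace ((C1 ** E1 s ** B1) ** QM ** transpose (C1 ** E1 s ** B1))) (at s)" for s
    using bounded_linear.has_vector_derivative[OF lin[of C1 "transpose C1"] matrix_exp_sandwich_deriv[of D S D s]]
    by (simp add: b_def[abs_def] E1_def eqS matrix_mult_bilinear_simps matrix_transpose_mul matrix_mul_assoc
        linear_neg[OF bounded_linear.linear[OF bounded_linear_trace]])
  have c': "(c has_vector_derivative - trace ((C ** E s ** B) ** QM ** transpose (C1 ** E1 s ** B1))) (at s)" for s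
    using bounded_linear.has_vector_derivative[OF lin[of C "transpose C1"] matrix_exp_sandwich_deriv[of A Pg D s]]
    by (simp add: c_def[abs_def] E_def E1_def eqPg matrix_mult_bilinear_simps matrix_transpose_mul matrix_mul_assoc
        linear_neg[OF bounded_linear.linear[OF bounded_linear_trace]])
  have \<phi>_eq: "?\<phi> s = trace ((C ** E s ** B) ** QM ** transpose (C ** E s ** B))
      + trace ((C1 ** E1 s ** B1) ** QM ** transpose (C1 ** E1 s ** B1))
      - 2 * trace ((C ** E s ** B) ** QM ** transpose (C1 ** E1 s ** B1))" for s
  proof -
    define U where "U = C ** E s ** B"
    define V where "V = C1 ** E1 s ** B1"
    have "trace (V ** QM ** transpose U) = trace (transpose (U ** QM ** transpose V))"
      by (simp add: matrix_transpose_mul sym matrix_mul_assoc)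
    then have "trace (V ** QM ** transpose U) = trace (U ** QM ** transpose V)"
      by (simp add: trace_transpose)
    then have "trace ((U - V) ** QM ** transpose (U - V))
      = trace (U ** QM ** transpose U) + trace (V ** QM ** transpose V) - 2 * trace (U ** QM ** transpose V)"
      by (simp add: transpose_diff matrix_mult_bilinear_simps trace_sub)
    then show ?thesis by (simp add: F_def U_def V_def E_def E1_def)
  qed
  have energy: "(?\<phi> has_integral ?K - (a t + b t - 2 * c t)) {0..t}" if "t \<ge> 0" for t
  proof -
    have der: "((\<lambda>t. a t + b t - 2 * c t) has_vector_derivative - ?\<phi> s) (at s)" for s
      unfolding \<phi>_eq
      by (rule has_vector_derivative_eq_rhs,
          rule has_vector_derivative_diff[OF has_vector_derivative_add[OF a' b']
            has_vector_derivative_mult_right[OF c']]) simp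
    have "((\<lambda>s. - ?\<phi> s) has_integral (a t + b t - 2 * c t) - (a 0 + b 0 - 2 * c 0)) {0..t}"
      by (rule fundamental_theorem_of_calculus[OF that]) (rule has_vector_derivative_at_within[OF der])
    from has_integral_neg[OF this] show ?thesis
      by (simp add: a_def b_def c_def E_def E1_def matrix_exp_0 transpose_mat)
  qed
  have \<phi>_nonneg: "?\<phi> s \<ge> 0" for s
    unfolding trace_congruence by (intro sum_nonneg psd)
  have b_nonneg: "b t \<ge> 0" for t
  proof -
    have "b t = trace ((C1 ** E1 t) ** S ** transpose (C1 ** E1 t))"
      by (simp add: b_def matrix_transpose_mul matrix_mul_assoc)
    also have "\<dots> \<ge> 0"
      unfolding trace_congruence
    proof (intro sum_nonneg)
      fix i show "0 \<le> (C1 ** E1 t) $ i \<bullet> (S *v ((C1 ** E1 t) $ i))"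
        using S[of "(C1 ** E1 t) $ i"] by (cases "(C1 ** E1 t) $ i = 0") (auto intro: less_imp_le)
    qed
    finally show ?thesis .
  qed
  have E_lim: "(E \<longlongrightarrow> 0) at_top" using stable by (simp add: E_def[abs_def])
  then have ET_lim: "((\<lambda>t. transpose (E t)) \<longlongrightarrow> 0) at_top"
    using bounded_linear.tendsto_zero[OF bounded_linear_transpose] by blast
  have "((\<lambda>t. E t ** P) \<longlongrightarrow> 0) at_top"
    by (rule bounded_linear.tendsto_zero[OF bounded_bilinear.bounded_linear_left[OF bounded_bilinear_matrix_mult] E_lim])
  from bounded_bilinear.tendsto_zero[OF bounded_bilinear_matrix_mult this ET_lim]
  have a_lim: "(a \<longlongrightarrow> 0) at_top"
    unfolding a_def[abs_def] by (rule bounded_linear.tendsto_zero[OF lin])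
  have "x \<bullet> ((B1 ** QM ** transpose B1) *v x) \<ge> 0" for x
    by (simp add: inner_congruence psd del: transpose_matrix_vector)
  from matrix_exp_bounded_of_lyapunov[OF S this eqS]
  obtain R where R: "\<And>t. t \<ge> 0 \<Longrightarrow> norm (E1 t) \<le> R"
    by (auto simp: E1_def)
  have "((\<lambda>t. E t ** Pg) \<longlongrightarrow> 0) at_top"
    by (rule bounded_linear.tendsto_zero[OF bounded_bilinear.bounded_linear_left[OF bounded_bilinear_matrix_mult] E_lim])
  then have "Zfun (\<lambda>t. E t ** Pg) at_top" by (simp add: tendsto_Zfun_iff)
  moreover have "Bfun (\<lambda>t. transpose (E1 t)) at_top"
  proof -
    obtain k where k: "k > 0" "\<And>X::real^'k^'k. norm (transpose X) \<le> norm X * k"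
      using bounded_linear.pos_bounded[OF bounded_linear_transpose] by auto
    have "\<forall>\<^sub>F t in at_top. norm (transpose (E1 t)) \<le> R * k"
      using eventually_ge_at_top[of 0]
    proof eventually_elim
      case (elim t)
      show ?case using k(2)[of "E1 t"] mult_right_mono[OF R[OF elim], of k] k(1) by linarith
    qed
    then show ?thesis by (rule BfunI)
  qed
  ultimately have "Zfun (\<lambda>t. E t ** Pg ** transpose (E1 t)) at_top"
    by (rule bounded_bilinear.Zfun_prod_Bfun[OF bounded_bilinear_matrix_mult])
  then have "((\<lambda>t. E t ** Pg ** transpose (E1 t)) \<longlongrightarrow> 0) at_top" by (simp add: tendsto_Zfun_iff)
  then have c_lim: "(c \<longlongrightarrow> 0) at_top"
    unfolding c_def[abs_def] by (rule bounded_linear.tendsto_zero[OF lin])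
  have "((\<lambda>T. ?K - a T + 2 * c T) \<longlongrightarrow> ?K - 0 + 2 * 0) at_top"
    by (intro tendsto_intros a_lim c_lim)
  moreover have "\<forall>\<^sub>F T in at_top. integral {0..t} ?\<phi> \<le> ?K - a T + 2 * c T"
    using eventually_ge_at_top[of t]
  proof eventually_elim
    case (elim T)
    then have T: "T \<ge> 0" using t by simp
    have "integral {0..t} ?\<phi> \<le> integral {0..T} ?\<phi>"
      by (rule integral_subset_le)
         (use elim \<phi>_nonneg energy[OF t] energy[OF T] in \<open>auto intro: has_integral_integrable\<close>)
    also have "\<dots> = ?K - (a T + b T - 2 * c T)"
      using energy[OF T] by (rule integral_unique)
    finally show ?case using b_nonneg[of T] by simp
  qed
  ultimately show ?thesis
    using tendsto_lowerbound[of "\<lambda>T. ?K - a T + 2 * c T" "?K - 0 + 2 * 0" at_top "integral {0..t} ?\<phi>"]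
    by simp
qed

section \<open>Balanced coordinates\<close>

lemma sum_UNIV_Plus:
  fixes f :: "'r::finite + 's::finite \<Rightarrow> 'a::comm_monoid_add"
  shows "(\<Sum>i\<in>UNIV. f i) = (\<Sum>i\<in>UNIV. f (Inl i)) + (\<Sum>j\<in>UNIV. f (Inr j))"
proof -
  have "(\<Sum>i\<in>UNIV. f i) = (\<Sum>i\<in>UNIV <+> UNIV. f i)" by (simp only: UNIV_Plus_UNIV)
  also have "\<dots> = (\<Sum>i\<in>UNIV. f (Inl i)) + (\<Sum>j\<in>UNIV. f (Inr j))"
    by (subst sum.Plus) (auto simp: o_def)
  finally show ?thesis .
qed

lemma block_mult:
  fixes X :: "real^('r::finite + 's::finite)^'p" and Y :: "real^'q^('r + 's)"
  shows "X ** Y = left_columns X ** upper_rows Y + right_columns X ** lower_rows Y"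
  by (simp add: matrix_matrix_mult_def left_columns_def right_columns_def upper_rows_def
      lower_rows_def sum_UNIV_Plus vec_eq_iff)

lemma rows_columns_mult:
  "upper_rows (X ** Y) = upper_rows X ** Y" "lower_rows (X ** Y) = lower_rows X ** Y"
  "left_columns (Z ** V) = Z ** left_columns V" "right_columns (Z ** V) = Z ** right_columns V"
  by (simp_all add: matrix_matrix_mult_def left_columns_def right_columns_def upper_rows_def
      lower_rows_def vec_eq_iff)

lemma rows_columns_linear:
  "upper_rows (X + Y) = upper_rows X + upper_rows Y" "upper_rows (- X) = - upper_rows X"
  "lower_rows (X + Y) = lower_rows X + lower_rows Y" "lower_rows (- X) = - lower_rows X"
  "left_columns (Z + V) = left_columns Z + left_columns V" "left_columns (- Z) = - left_columns Z"
  "right_columns (Z + V) = right_columns Z + right_columns V" "right_columns (- Z) = - right_columns Z"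
  by (simp_all add: left_columns_def right_columns_def upper_rows_def lower_rows_def vec_eq_iff)

lemma rows_columns_transpose:
  "upper_rows (transpose X) = transpose (left_columns X)"
  "lower_rows (transpose X) = transpose (right_columns X)"
  "left_columns (transpose Y) = transpose (upper_rows Y)"
  "right_columns (transpose Y) = transpose (lower_rows Y)"
  by (simp_all add: left_columns_def right_columns_def upper_rows_def lower_rows_def transpose_def vec_eq_iff)

lemma left_columns_upper_rows:
  "left_columns (upper_rows X) = upper_rows (left_columns X)"
  "right_columns (upper_rows X) = upper_rows (right_columns X)"
  "left_columns (lower_rows X) = lower_rows (left_columns X)"
  "right_columns (lower_rows X) = lower_rows (right_columns X)"
  by (simp_all add: left_columns_def right_columns_def upper_rows_def lower_rows_def vec_eq_iff)

lemma trace_block: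
  "trace X = trace (upper_rows (left_columns X)) + trace (lower_rows (right_columns X))"
  by (simp add: trace_def left_columns_def right_columns_def upper_rows_def lower_rows_def sum_UNIV_Plus)

lemma trace_neg: "trace (- X) = - trace (X :: real^'n^'n)"
  by (simp add: trace_def sum_negf)

lemma trace_scaleR: "trace (c *\<^sub>R X) = c * trace (X :: real^'n^'n)"
  by (simp add: trace_def sum_distrib_left)

text \<open>Both sides equal \<open>- 2 tr (S S A)\<close>.\<close>

lemma gramian_trace_duality:
  fixes A S V W :: "real^'n^'n"
  assumes "transpose S = S" and 1: "A ** S + S ** transpose A = - W"
    and 2: "transpose A ** S + S ** A = - V"
  shows "trace (V ** S) = trace (S ** W)"
proof -
  have "trace (transpose A ** S ** S) = trace (transpose (S ** S ** A))"
    by (simp add: matrix_transpose_mul assms(1) matrix_mul_assoc)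
  then have t1: "trace (transpose A ** S ** S) = trace (S ** S ** A)"
    by (simp add: trace_transpose)
  have t2: "trace (S ** A ** S) = trace (S ** S ** A)"
    using trace_mul_sym[of "S ** A" S] by (simp add: matrix_mul_assoc)
  have "trace (S ** S ** transpose A) = trace (transpose (A ** S ** S))"
    by (simp add: matrix_transpose_mul assms(1) matrix_mul_assoc)
  then have t3: "trace (S ** S ** transpose A) = trace (S ** S ** A)"
    using trace_mul_sym[of A "S ** S"] by (simp add: trace_transpose matrix_mul_assoc)
  have "- trace (V ** S) = trace ((transpose A ** S + S ** A) ** S)"
    by (simp add: 2 matrix_mult_bilinear_simps trace_neg)
  moreover have "- trace (S ** W) = trace (S ** (A ** S + S ** transpose A))"
    by (simp add: 1 matrix_mult_bilinear_simps trace_neg)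
  ultimately show ?thesis
    using t1 t2 t3 by (simp add: matrix_mult_bilinear_simps matrix_mul_assoc trace_add)
qed

context
  fixes A S :: "real^('r::finite + 's::finite)^('r + 's)" and B :: "real^'m^('r + 's)"
    and C :: "real^('r + 's)^'p" and QM :: "real^'m^'m"
  assumes reach: "A ** S + S ** transpose A = - (B ** QM ** transpose B)"
    and obs: "transpose A ** S + S ** A = - (transpose C ** C)"
    and off_diag: "upper_rows (right_columns S) = 0" "lower_rows (left_columns S) = 0"
begin

text \<open>Truncation keeps both Lyapunov equations: as \<open>S\<close> is block diagonal, their upper left blocks involve
  only the upper left blocks of \<open>A\<close> and \<open>S\<close>.\<close>

lemma truncated_reachability_equation:
  "upper_rows (left_columns A) ** upper_rows (left_columns S)
     + upper_rows (left_columns S) ** transpose (upper_rows (left_columns A))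
   = - (upper_rows B ** QM ** transpose (upper_rows B))"
  using arg_cong[OF reach, of "\<lambda>X. left_columns (upper_rows X)"]
  by (simp add: rows_columns_linear rows_columns_mult rows_columns_transpose left_columns_upper_rows
      block_mult[of "upper_rows A"] block_mult[of "upper_rows S"] off_diag
      matrix_mult_bilinear_simps)

lemma truncated_observability_equation:
  "transpose (upper_rows (left_columns A)) ** upper_rows (left_columns S)
     + upper_rows (left_columns S) ** upper_rows (left_columns A)
   = - (transpose (left_columns C) ** left_columns C)"
  using arg_cong[OF obs, of "\<lambda>X. left_columns (upper_rows X)"]
  by (simp add: rows_columns_linear rows_columns_mult rows_columns_transpose left_columns_upper_rows
      block_mult[of "transpose (left_columns A)"] block_mult[of "upper_rows S"] off_diag
      matrix_mult_bilinear_simps)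

text \<open>The first two traces equal \<open>tr (S B QM B\<^sup>T)\<close> and \<open>tr (S1 B1 QM B1\<^sup>T)\<close> by duality.  In the third,
  \<open>C1\<^sup>T C\<close> is read off the upper rows of the observability equation; the equation for \<open>Pg\<close> then cancels
  everything that contains \<open>A11\<close>, and what is left is
  \<open>tr (S1 B1 QM B1\<^sup>T) - tr (S2 Pg2 A21\<^sup>T)\<close>.  All terms with \<open>S1\<close> cancel in the total.\<close>

lemma balanced_truncation_trace_identity:
  fixes Pg :: "real^'r^('r + 's)"
  assumes sym: "transpose S = S"
    and cross: "A ** Pg + Pg ** transpose (upper_rows (left_columns A))
      = - (B ** QM ** transpose (upper_rows B))"
  shows "trace (C ** S ** transpose C)
      + trace (left_columns C ** upper_rows (left_columns S) ** transpose (left_columns C))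
      - 2 * trace (C ** Pg ** transpose (left_columns C))
    = trace (lower_rows (right_columns S) ** (lower_rows B ** QM ** transpose (lower_rows B)
        + 2 *\<^sub>R (lower_rows Pg ** transpose (lower_rows (left_columns A)))))"
proof -
  define A11 where "A11 = upper_rows (left_columns A)"
  define A21 where "A21 = lower_rows (left_columns A)"
  define B1 where "B1 = upper_rows B"
  define B2 where "B2 = lower_rows B"
  define C1 where "C1 = left_columns C"
  define S1 where "S1 = upper_rows (left_columns S)"
  define S2 where "S2 = lower_rows (right_columns S)"
  define Pg1 where "Pg1 = upper_rows Pg"
  define Pg2 where "Pg2 = lower_rows Pg"
  have sym1: "transpose S1 = S1"
    unfolding S1_def by (metis sym left_columns_upper_rows(1) rows_columns_transpose(1,3))
  have full: "trace (C ** S ** transpose C)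
      = trace (S1 ** (B1 ** QM ** transpose B1)) + trace (S2 ** (B2 ** QM ** transpose B2))"
  proof -
    have "trace (C ** S ** transpose C) = trace (transpose C ** C ** S)"
      using trace_mul_sym[of "C ** S" "transpose C"] by (simp add: matrix_mul_assoc)
    also have "\<dots> = trace (S ** (B ** QM ** transpose B))"
      by (rule gramian_trace_duality[OF sym reach obs])
    also have "\<dots> = trace (S1 ** (B1 ** QM ** transpose B1)) + trace (S2 ** (B2 ** QM ** transpose B2))"
      by (subst trace_block)
         (simp add: rows_columns_mult rows_columns_transpose left_columns_upper_rows
          block_mult[of "upper_rows S"] block_mult[of "lower_rows S"] off_diag
          matrix_mult_bilinear_simps S1_def S2_def B1_def B2_def flip: matrix_mul_assoc)
    finally show ?thesis .
  qed
  have reduced: "trace (C1 ** S1 ** transpose C1) = trace (S1 ** (B1 ** QM ** transpose B1))"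
  proof -
    have "trace (C1 ** S1 ** transpose C1) = trace (transpose C1 ** C1 ** S1)"
      using trace_mul_sym[of "C1 ** S1" "transpose C1"] by (simp add: matrix_mul_assoc)
    also have "\<dots> = trace (S1 ** (B1 ** QM ** transpose B1))"
      by (rule gramian_trace_duality[OF sym1,
            OF truncated_reachability_equation[folded A11_def B1_def S1_def]
               truncated_observability_equation[folded A11_def C1_def S1_def]])
    finally show ?thesis .
  qed
  have mixed: "trace (C ** Pg ** transpose C1)
      = trace (S1 ** (B1 ** QM ** transpose B1)) - trace (S2 ** (Pg2 ** transpose A21))"
  proof -
    have "transpose C1 ** C = - (transpose (left_columns A) ** S + upper_rows S ** A)"
      using arg_cong[OF obs, of upper_rows]
      by (simp add: rows_columns_linear rows_columns_mult rows_columns_transpose C1_def)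
    then have "trace (transpose C1 ** C ** Pg)
        = - trace (transpose (left_columns A) ** (S ** Pg)) - trace (upper_rows S ** (A ** Pg))"
      by (simp add: matrix_mult_bilinear_simps matrix_mul_assoc trace_neg trace_add trace_sub)
    moreover have "A ** Pg = - (B ** QM ** transpose B1) - Pg ** transpose A11"
      using cross by (simp add: B1_def A11_def algebra_simps)
    then have "trace (upper_rows S ** (A ** Pg))
        = - trace (S1 ** (B1 ** QM ** transpose B1)) - trace (S1 ** Pg1 ** transpose A11)"
      by (simp add: block_mult[of "upper_rows S"] left_columns_upper_rows off_diag rows_columns_mult
          matrix_mult_bilinear_simps rows_columns_linear trace_neg trace_add trace_sub
          S1_def B1_def Pg1_def flip: matrix_mul_assoc)
    moreover have "transpose (left_columns A) ** (S ** Pg)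
        = transpose A11 ** (S1 ** Pg1) + transpose A21 ** (S2 ** Pg2)"
      by (subst block_mult)
         (simp add: rows_columns_mult rows_columns_transpose block_mult[of "upper_rows S"]
          block_mult[of "lower_rows S"] left_columns_upper_rows off_diag matrix_mult_bilinear_simps
          A11_def A21_def S1_def S2_def Pg1_def Pg2_def)
    moreover have "trace (transpose A11 ** (S1 ** Pg1)) = trace (S1 ** Pg1 ** transpose A11)"
      by (rule trace_mul_sym)
    moreover have "trace (transpose A21 ** (S2 ** Pg2)) = trace (S2 ** (Pg2 ** transpose A21))"
      using trace_mul_sym[of "transpose A21" "S2 ** Pg2"] by (simp add: matrix_mul_assoc)
    moreover have "trace (C ** Pg ** transpose C1) = trace (transpose C1 ** C ** Pg)"
      using trace_mul_sym[of "C ** Pg" "transpose C1"] by (simp add: matrix_mul_assoc)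
    ultimately show ?thesis by (simp add: trace_add)
  qed
  have "trace (C ** S ** transpose C) + trace (C1 ** S1 ** transpose C1)
      - 2 * trace (C ** Pg ** transpose C1)
    = trace (S2 ** (B2 ** QM ** transpose B2 + 2 *\<^sub>R (Pg2 ** transpose A21)))"
    by (simp add: full reduced mixed matrix_mult_bilinear_simps trace_add trace_scaleR)
  then show ?thesis
    by (simp only: A21_def B2_def C1_def S1_def S2_def Pg2_def)
qed

end

lemma diag_matrix_mult: "diag_matrix d ** diag_matrix e = diag_matrix (\<lambda>i. d i * e i)"
  by (simp add: diag_matrix_def matrix_matrix_mult_def vec_eq_iff if_distrib[of "\<lambda>x. x * _"]
      if_distrib[of "\<lambda>x. _ * x"] cong: if_cong)

lemma transpose_diag_matrix: "transpose (diag_matrix d) = diag_matrix d"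
  by (simp add: diag_matrix_def transpose_def vec_eq_iff)

lemma diag_matrix_quadratic_form: "x \<bullet> (diag_matrix d *v x) = (\<Sum>i\<in>UNIV. d i * (x $ i)\<^sup>2)"
proof -
  have "diag_matrix d *v x = (\<chi> i. d i * x $ i)"
    by (simp add: diag_matrix_def matrix_vector_mult_def vec_eq_iff if_distrib[of "\<lambda>x. x * _"] cong: if_cong)
  then show ?thesis by (simp add: inner_vec_def power2_eq_square mult_ac)
qed

lemma coord_number_range: "coord_number (i :: 'r::{finite,linorder} + 's::{finite,linorder}) \<in> {1..CARD('r + 's)}"
proof (cases i)
  case (Inl a)
  have "card {..a} \<ge> 1" by (simp add: Suc_le_eq card_gt_0_iff)
  moreover have "card {..a} \<le> CARD('r)" by (rule card_mono) auto
  ultimately show ?thesis using Inl by (simp add: card_UNIV_sum)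
next
  case (Inr b)
  have "card {..b} \<ge> 1" by (simp add: Suc_le_eq card_gt_0_iff)
  moreover have "card {..b} \<le> CARD('s)" by (rule card_mono) auto
  ultimately show ?thesis using Inr by (simp add: card_UNIV_sum)
qed

text \<open>If \<open>P Q v = l v\<close> with \<open>v \<noteq> 0\<close>, then pairing with \<open>Q v\<close> expresses \<open>l\<close> as a quotient of values of the
  two positive forms.  Positivity of \<open>l\<close> itself is needed, since \<open>sqrt\<close> of a negative number is
  negative rather than undefined.\<close>

lemma hankel_singular_value_pos:
  fixes P Q :: "real^'n^'n"
  assumes P: "positive_definite P" and Q: "positive_definite Q"
    and \<sigma>: "hankel_singular_values P Q \<sigma>" and k: "k \<in> {1..CARD('n)}"
  shows "\<sigma> k > 0"
proof -
  obtain l where l: "\<And>x. det (mat x - P ** Q) = (\<Prod>k=1..CARD('n). x - l k)" "\<sigma> k = sqrt (l k)"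
    using \<sigma> k unfolding hankel_singular_values_def ordered_eigenvalues_def by blast
  have "(\<Prod>j=1..CARD('n). l k - l j) = 0"
    by (rule prod_zero) (use k in auto)
  then have det0: "det (mat (l k) - P ** Q) = 0"
    using l(1)[of "l k"] by simp
  then have "\<not> invertible (mat (l k) - P ** Q)"
    by (simp add: invertible_det_nz)
  then obtain v where v: "v \<noteq> 0" "(mat (l k) - P ** Q) *v v = 0"
    unfolding invertible_left_inverse matrix_left_invertible_ker by blast
  have "mat (l k) *v v = l k *\<^sub>R v"
    by (simp add: vec_eq_iff mat_def matrix_vector_mult_def if_distrib[of "\<lambda>x. x * _"] cong: if_cong)
  then have eig: "P *v (Q *v v) = l k *\<^sub>R v"
    using v(2) by (simp add: matrix_vector_mult_diff_rdistrib matrix_vector_mul_assoc)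
  have vQ: "0 < v \<bullet> (Q *v v)" using Q v(1) by (simp add: positive_definite_def)
  then have "Q *v v \<noteq> 0" by auto
  then have "0 < (Q *v v) \<bullet> (P *v (Q *v v))" using P by (simp add: positive_definite_def)
  also have "\<dots> = l k * (v \<bullet> (Q *v v))" by (simp add: eig inner_commute)
  finally have "l k > 0" using vQ by (simp add: zero_less_mult_iff)
  then show ?thesis by (simp add: l(2))
qed

lemma balancing_transformation_balances:
  fixes P Q T :: "real^('r::{finite,linorder} + 's::{finite,linorder})^('r + 's)"
  assumes pos: "\<And>k. k \<in> {1..CARD('r + 's)} \<Longrightarrow> \<sigma> k > 0"
    and T: "balancing_transformation P Q \<sigma> T"
  shows "T ** P ** transpose T = hankel_matrix \<sigma>"
    and "transpose T ** hankel_matrix \<sigma> ** T = Q"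
proof -
  obtain K L U V :: "real^('r + 's)^('r + 's)" where
    PQ: "P = K ** transpose K" "Q = L ** transpose L"
    and orth: "orthogonal_matrix U" "orthogonal_matrix V"
    and svd: "transpose K ** L = V ** hankel_matrix \<sigma> ** transpose U"
    and T_eq: "T = diag_matrix (\<lambda>i. 1 / sqrt (\<sigma> (coord_number i))) ** transpose U ** transpose L"
    using T unfolding balancing_transformation_def by blast
  define s :: "'r + 's \<Rightarrow> real" where "s i = \<sigma> (coord_number i)" for i
  have s: "s i > 0" for i unfolding s_def by (intro pos coord_number_range)
  define D where "D = diag_matrix (\<lambda>i. 1 / sqrt (s i))"
  define H where "H = diag_matrix s"
  have hH: "hankel_matrix \<sigma> = H" by (simp add: hankel_matrix_def H_def s_def[abs_def])
  have sym: "transpose D = D" "transpose H = H" by (simp_all add: D_def H_def transpose_diag_matrix)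
  have "(1 / sqrt (s i)) * s i = sqrt (s i)" for i
    using s[of i] by (simp add: real_div_sqrt)
  then have DH: "D ** H = diag_matrix (\<lambda>i. sqrt (s i))"
    by (simp add: D_def H_def diag_matrix_mult)
  then have HD: "H ** D = diag_matrix (\<lambda>i. sqrt (s i))"
    by (simp add: D_def H_def diag_matrix_mult mult.commute)
  have "sqrt (s i) * (1 / sqrt (s i)) = 1" "sqrt (s i) * sqrt (s i) = s i" for i
    using s[of i] by simp_all
  then have DHD: "D ** H ** D = mat 1" and DHHD: "D ** H ** (H ** D) = H"
    unfolding DH HD unfolding D_def H_def diag_matrix_mult
    by (simp_all only:) (simp add: diag_matrix_def mat_def)
  have U: "transpose U ** U = mat 1" "U ** transpose U = mat 1" and V: "transpose V ** V = mat 1"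
    using orth by (auto simp: orthogonal_matrix_def)
  have T': "T = D ** transpose U ** transpose L" by (simp add: T_eq D_def s_def)
  have X: "transpose K ** L ** U = V ** H"
  proof -
    have "transpose K ** L ** U = V ** H ** (transpose U ** U)"
      by (simp only: svd hH matrix_mul_assoc)
    then show ?thesis by (simp only: U(1) matrix_mul_rid)
  qed
  have "T ** P ** transpose T = D ** transpose (transpose K ** L ** U) ** (transpose K ** L ** U) ** D"
    by (simp add: T' PQ matrix_transpose_mul sym matrix_mul_assoc)
  also have "\<dots> = D ** (H ** (transpose V ** V) ** H) ** D"
    unfolding X by (simp add: matrix_transpose_mul sym matrix_mul_assoc)
  also have "\<dots> = H" using DHHD by (simp add: V matrix_mul_assoc)
  finally show "T ** P ** transpose T = hankel_matrix \<sigma>" by (simp add: hH)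
  have "transpose T ** H ** T = L ** U ** (D ** H ** D) ** transpose U ** transpose L"
    by (simp add: T' matrix_transpose_mul sym matrix_mul_assoc)
  also have "\<dots> = L ** (U ** transpose U) ** transpose L"
    by (simp add: DHD matrix_mul_assoc)
  also have "\<dots> = Q" by (simp add: U PQ)
  finally show "transpose T ** hankel_matrix \<sigma> ** T = Q" by (simp add: hH)
qed

section \<open>Paths of linear equations with additive noise\<close>

text \<open>Near every point of the interval the one-sided limits bound the path on both sides; bisection
  makes these local bounds global.\<close>

lemma cadlag_bounded:
  fixes f :: "real \<Rightarrow> 'a::real_normed_vector"
  assumes f: "cadlag f" and a: "a \<ge> 0"
  obtains K where "\<And>s. s \<in> {0..a} \<Longrightarrow> norm (f s) \<le> K"
proof -
  define N :: "real set" where "N = {0..}"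
  have "bounded (f ` ({0..a} \<inter> N))"
    using a
  proof (induction rule: Bolzano)
    case (trans u v w)
    have "{u..w} = {u..v} \<union> {v..w}" using trans(3,4) by auto
    then have "f ` ({u..w} \<inter> N) = f ` ({u..v} \<inter> N) \<union> f ` ({v..w} \<inter> N)" by auto
    then show ?case using trans(1,2) by (simp only: bounded_Un)
  next
    case (local x)
    have "(f \<longlongrightarrow> f x) (at_right x)" using f local(1) by (simp add: cadlag_def)
    from tendstoD[OF this zero_less_one] obtain r where r: "r > x" "\<And>y. x < y \<Longrightarrow> y < r \<Longrightarrow> dist (f y) (f x) < 1"
      by (auto simp: eventually_at_right[OF less_add_one[of x]])
    have "\<exists>l l'. l < x \<and> (\<forall>y. l < y \<and> y < x \<and> 0 \<le> y \<longrightarrow> dist (f y) l' < 1)"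
    proof (cases "x > 0")
      case True
      then obtain l' where "(f \<longlongrightarrow> l') (at_left x)" using f by (auto simp: cadlag_def)
      from tendstoD[OF this zero_less_one] show ?thesis
        by (auto simp: eventually_at_left[of "x - 1" x])
    next
      case False
      then show ?thesis by (intro exI[of _ "x - 1"]) auto
    qed
    then obtain l l' where l: "l < x" "\<And>y. l < y \<Longrightarrow> y < x \<Longrightarrow> 0 \<le> y \<Longrightarrow> dist (f y) l' < 1" by blast
    define d where "d = min (r - x) (x - l)"
    have "bounded (f ` ({u..v} \<inter> N))" if "u \<le> x" "x \<le> v" "v - u < d" for u v
    proof (rule bounded_subset)
      show "bounded (ball (f x) 1 \<union> ball l' 1 \<union> {f x})" by simp
      show "f ` ({u..v} \<inter> N) \<subseteq> ball (f x) 1 \<union> ball l' 1 \<union> {f x}"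
      proof (rule image_subsetI)
        fix y assume y: "y \<in> {u..v} \<inter> N"
        show "f y \<in> ball (f x) 1 \<union> ball l' 1 \<union> {f x}"
        proof (cases y x rule: linorder_cases)
          case less
          then have "dist (f y) l' < 1" using y that by (intro l(2)) (auto simp: d_def N_def)
          then show ?thesis by (simp add: dist_commute)
        next
          case greater
          then have "dist (f y) (f x) < 1" using y that by (intro r(2)) (auto simp: d_def)
          then show ?thesis by (simp add: dist_commute)
        qed simp
      qed
    qed
    moreover have "d > 0" using r l by (simp add: d_def)
    ultimately show ?case by blast
  qed
  moreover have "{0..a} \<inter> N = {0..a}" by (auto simp: N_def)
  ultimately have "bounded (f ` {0..a})" by simp
  then show thesis using that unfolding bounded_iff by blast
qed

text \<open>The pieces may disagree with \<open>\<psi>\<close> at the right end of each cell, which is how step functions sampled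
  at grid points behave.\<close>

lemma has_integral_grid:
  fixes h :: real and \<psi> :: "real \<Rightarrow> 'a::banach"
  assumes h: "h \<ge> 0"
    and int: "\<And>k. k < N \<Longrightarrow> (\<phi> k has_integral I k) {h * real k..h * real (Suc k)}"
    and eq: "\<And>k s. k < N \<Longrightarrow> h * real k \<le> s \<Longrightarrow> s < h * real (Suc k) \<Longrightarrow> \<psi> s = \<phi> k s"
  shows "(\<psi> has_integral (\<Sum>k<N. I k)) {0..h * real N}"
  using int eq
proof (induction N)
  case (Suc N)
  have "(\<psi> has_integral (\<Sum>k<N. I k)) {0..h * real N}"
    using Suc.prems by (intro Suc.IH) auto
  moreover have "(\<psi> has_integral I N) {h * real N..h * real (Suc N)}"
    by (rule has_integral_spike_finite[OF _ _ Suc.prems(1), of "{h * real (Suc N)}"])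
       (use Suc.prems(2)[of N] in auto)
  ultimately show ?case
    using h by (simp only: sum.lessThan_Suc) (rule has_integral_combine[where c = "h * real N"]; simp add: algebra_simps)
next
  case 0
  show ?case using has_integral_null_real[of 0 0 \<psi>] by simp
qed

text \<open>For \<open>s\<close> in a cell of the grid of mesh \<open>h\<close>, \<open>prev_grid h s\<close> and \<open>next_grid h s\<close> are the ends of this cell.
  The point \<open>next_grid h s\<close> always lies strictly to the right of \<open>s\<close>, so sampling a right-continuous path
  there converges at every \<open>s\<close>.\<close>

definition prev_grid :: "real \<Rightarrow> real \<Rightarrow> real" where
  "prev_grid h s = h * \<lfloor>s / h\<rfloor>"

definition next_grid :: "real \<Rightarrow> real \<Rightarrow> real" where
  "next_grid h s = h * (\<lfloor>s / h\<rfloor> + 1)"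

lemma grid_eq:
  assumes "h > 0" "h * real k \<le> s" "s < h * real (Suc k)"
  shows "prev_grid h s = h * real k" "next_grid h s = h * real (Suc k)"
proof -
  have "\<lfloor>s / h\<rfloor> = int k" using assms by (intro floor_unique) (auto simp: field_simps)
  then show "prev_grid h s = h * real k" "next_grid h s = h * real (Suc k)"
    by (simp_all add: prev_grid_def next_grid_def algebra_simps)
qed

lemma grid_bounds:
  assumes "h > 0"
  shows "s < next_grid h s" "next_grid h s \<le> s + h" "prev_grid h s \<le> s" "s - h \<le> prev_grid h s"
proof -
  have "h * of_int \<lfloor>s / h\<rfloor> \<le> h * (s / h)" "h * (s / h) < h * (of_int \<lfloor>s / h\<rfloor> + 1)"
    using assms by (intro mult_left_mono mult_strict_left_mono; linarith)+
  then show "s < next_grid h s" "next_grid h s \<le> s + h" "prev_grid h s \<le> s" "s - h \<le> prev_grid h s"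
    using assms by (simp_all add: prev_grid_def next_grid_def algebra_simps)
qed

lemma prev_grid_nonneg: "h > 0 \<Longrightarrow> s \<ge> 0 \<Longrightarrow> prev_grid h s \<ge> 0"
  by (simp add: prev_grid_def)

lemma mesh_tendsto: "(\<lambda>n. t / real (Suc n)) \<longlonglongrightarrow> 0"
  using tendsto_mult[OF tendsto_const LIMSEQ_inverse_real_of_nat, of t] by (simp add: divide_inverse)

lemma next_grid_tendsto:
  assumes "t > 0"
  shows "filterlim (\<lambda>n. next_grid (t / real (Suc n)) s) (at_right s) sequentially"
proof (rule tendsto_imp_filterlim_at_right)
  have h: "t / real (Suc n) > 0" for n using assms by simp
  show "(\<lambda>n. next_grid (t / real (Suc n)) s) \<longlonglongrightarrow> s"
  proof (rule tendsto_sandwich[OF _ _ tendsto_const])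
    show "(\<lambda>n. s + t / real (Suc n)) \<longlonglongrightarrow> s"
      using tendsto_add[OF tendsto_const mesh_tendsto, of s t] by simp
    show "\<forall>\<^sub>F n in sequentially. s \<le> next_grid (t / real (Suc n)) s"
      "\<forall>\<^sub>F n in sequentially. next_grid (t / real (Suc n)) s \<le> s + t / real (Suc n)"
      using grid_bounds(1)[OF h, of s] grid_bounds(2)[OF h, of _ s]
      by (auto intro!: always_eventually less_imp_le simp del: of_nat_Suc)
  qed
  show "\<forall>\<^sub>F n in sequentially. s < next_grid (t / real (Suc n)) s"
    using grid_bounds(1)[OF h] by simp
qed

lemma prev_grid_tendsto:
  assumes "t > 0"
  shows "(\<lambda>n. prev_grid (t / real (Suc n)) s) \<longlonglongrightarrow> s"
proof (rule tendsto_sandwich)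
  have h: "t / real (Suc n) > 0" for n using assms by simp
  show "(\<lambda>n. s - t / real (Suc n)) \<longlonglongrightarrow> s"
    using tendsto_diff[OF tendsto_const mesh_tendsto, of s t] by simp
  show "\<forall>\<^sub>F n in sequentially. s - t / real (Suc n) \<le> prev_grid (t / real (Suc n)) s"
    "\<forall>\<^sub>F n in sequentially. prev_grid (t / real (Suc n)) s \<le> s"
    using grid_bounds(3,4)[OF h] by (auto intro!: always_eventually simp del: of_nat_Suc)
qed simp

text \<open>The sums are the integrals of the step functions that sample \<open>f\<close> at the right end of each cell; these
  converge pointwise by right continuity, so dominated convergence applies.  The range \<open>{0..2 * t}\<close>
  covers the sample point \<open>t + h\<close> belonging to \<open>s = t\<close>.\<close>

lemma right_endpoint_riemann_sum:
  fixes f :: "real \<Rightarrow> 'a::euclidean_space"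
  assumes t: "t > 0"
    and right_cont: "\<And>s. s \<ge> 0 \<Longrightarrow> (f \<longlongrightarrow> f s) (at_right s)"
    and K: "\<And>s. s \<in> {0..2 * t} \<Longrightarrow> norm (f s) \<le> K"
  shows "f integrable_on {0..t}"
    and "(\<lambda>n. \<Sum>k<Suc n. (t / real (Suc n)) *\<^sub>R f (t / real (Suc n) * real (Suc k))) \<longlonglongrightarrow> integral {0..t} f"
proof -
  define h where "h n = t / real (Suc n)" for n
  define g where "g n s = f (next_grid (h n) s)" for n s
  have h: "h n > 0" and h_t: "h n * real (Suc n) = t" and h_le: "h n \<le> t" for n
    using t by (auto simp: h_def field_simps simp del: of_nat_Suc)
  have g: "(g n has_integral (\<Sum>k<Suc n. h n *\<^sub>R f (h n * real (Suc k)))) {0..t}" for n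
  proof -
    have "(g n has_integral (\<Sum>k<Suc n. h n *\<^sub>R f (h n * real (Suc k)))) {0..h n * real (Suc n)}"
    proof (rule has_integral_grid)
      show "((\<lambda>_. f (h n * real (Suc k))) has_integral h n *\<^sub>R f (h n * real (Suc k)))
          {h n * real k..h n * real (Suc k)}" for k
        using has_integral_const_real[of "f (h n * real (Suc k))" "h n * real k" "h n * real (Suc k)"] h[of n]
        by (simp add: algebra_simps)
    qed (use h[of n] in \<open>auto simp: g_def grid_eq simp del: of_nat_Suc\<close>)
    then show ?thesis by (simp only: h_t)
  qed
  have bound: "norm (g n s) \<le> K" if "s \<in> {0..t}" for n s
    unfolding g_def using that grid_bounds(1,2)[OF h[of n], of s] h_le[of n] by (intro K) auto
  have lim: "(\<lambda>n. g n s) \<longlonglongrightarrow> f s" if "s \<in> {0..t}" for s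
    unfolding g_def h_def
    by (rule filterlim_compose[OF right_cont next_grid_tendsto]) (use that t in auto)
  note dc = dominated_convergence[of g "{0..t}" "\<lambda>_. K" f, OF has_integral_integrable[OF g] _ bound lim]
  show "f integrable_on {0..t}" by (rule dc(1)) (simp_all add: integrable_const_ivl)
  have "(\<lambda>n. integral {0..t} (g n)) \<longlonglongrightarrow> integral {0..t} f"
    by (rule dc(2)) (simp_all add: integrable_const_ivl)
  then show "(\<lambda>n. \<Sum>k<Suc n. (t / real (Suc n)) *\<^sub>R f (t / real (Suc n) * real (Suc k))) \<longlonglongrightarrow> integral {0..t} f"
    using integral_unique[OF g] by (simp add: h_def del: of_nat_Suc sum.lessThan_Suc)
qed

text \<open>This is the formula \<open>x t = \<integral> e\<^bsup>(t-s)A\<^esup> B dm(s)\<close> along a single path, with the integral written as a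
  limit of left-endpoint sums.  Expressing the increments of \<open>B m\<close> through those of \<open>x\<close> by the equation and
  summing by parts turns the sum into \<open>x t\<close> plus the integral of a remainder \<open>r\<close>.  Since the summation by
  parts evaluates \<open>x\<close> at right endpoints, \<open>r\<close> tends to \<open>0\<close> at every point, and dominated convergence
  finishes the proof.\<close>

lemma variation_of_constants_limit:
  fixes A :: "real^'n^'n" and B :: "real^'m^'n"
  assumes x: "cadlag x" and x0: "x 0 = 0" and t: "t > 0"
    and eq: "\<And>s. s \<ge> 0 \<Longrightarrow> x s = integral {0..s} (\<lambda>u. A *v x u) + B *v (m s - m 0)"
  defines "h \<equiv> \<lambda>n. t / real (Suc n)"
  shows "(\<lambda>n. \<Sum>k<Suc n. (matrix_exp ((t - h n * real k) *\<^sub>R A) ** B) *v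
            (m (h n * real (Suc k)) - m (h n * real k))) \<longlonglongrightarrow> x t"
proof -
  obtain K where K: "\<And>s. s \<in> {0..2 * t} \<Longrightarrow> norm (x s) \<le> K"
    using cadlag_bounded[OF x, of "2 * t"] t by auto
  have right_cont: "(x \<longlongrightarrow> x s) (at_right s)" if "s \<ge> 0" for s
    using x that by (simp add: cadlag_def)
  have h: "h n > 0" and h_t: "h n * real (Suc n) = t" and h_le: "h n \<le> t" for n
    using t by (auto simp: h_def field_simps simp del: of_nat_Suc)
  define \<Phi> where "\<Phi> s = matrix_exp ((t - s) *\<^sub>R A)" for s
  have \<Phi>': "(\<Phi> has_vector_derivative - (\<Phi> s ** A)) (at s)" for s
  proof -
    have "((\<lambda>s. matrix_exp (s *\<^sub>R A)) \<circ> (\<lambda>s. t - s) has_vector_derivative (-1) *\<^sub>R (A ** matrix_exp ((t - s) *\<^sub>R A))) (at s)"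
      by (rule vector_diff_chain_at[OF _ matrix_exp_deriv_left])
         (auto intro!: derivative_eq_intros simp flip: has_real_derivative_iff_has_vector_derivative)
    then show ?thesis by (simp add: \<Phi>_def[abs_def] o_def matrix_exp_commute)
  qed
  have \<Phi>_cont: "continuous_on S \<Phi>" for S
    by (rule has_vector_derivative_imp_continuous_on[OF \<Phi>'])
  have vec_lin: "bounded_linear (\<lambda>X::real^'n^'n. X *v v)" "bounded_linear (\<lambda>v. X *v v)"
    for v :: "real^'n" and X :: "real^'n^'n"
    by (intro bounded_bilinear.bounded_linear_left bounded_bilinear.bounded_linear_right
        bounded_bilinear_matrix_vector_mult)+
  obtain c where c: "c > 0" "\<And>(X::real^'n^'n) v. norm (X *v v) \<le> norm X * norm v * c"
    using bounded_bilinear.pos_bounded[OF bounded_bilinear_matrix_vector_mult] by auto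
  have \<Phi>A_cont: "continuous_on S (\<lambda>s. \<Phi> s ** A)" for S
    by (rule bounded_linear.continuous_on[OF bounded_bilinear.bounded_linear_left[OF bounded_bilinear_matrix_mult] \<Phi>_cont])
  have "compact ((\<lambda>s. \<Phi> s ** A) ` {0..t})"
    by (intro compact_continuous_image \<Phi>A_cont) simp
  from compact_imp_bounded[OF this] obtain R where R: "\<And>s. s \<in> {0..t} \<Longrightarrow> norm (\<Phi> s ** A) \<le> R"
    unfolding bounded_iff by blast
  have x_int: "x integrable_on {a..b}" if "0 \<le> a" "b \<le> t" for a b
    by (rule integrable_subinterval_real[OF right_endpoint_riemann_sum(1)[OF t right_cont K]])
       (use that in auto)
  have Ax_int: "(\<lambda>u. A *v x u) integrable_on {a..b}" if "0 \<le> a" "b \<le> t" for a b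
    using integrable_linear[OF x_int[OF that] vec_lin(2)[of A]] by (simp add: o_def)
  \<comment> \<open>The first term comes from the change of \<open>\<Phi>\<close> over the cell, the second from the drift of \<open>x\<close>.\<close>
  define r where "r n s = (\<Phi> s ** A) *v x (next_grid (h n) s) - (\<Phi> (prev_grid (h n) s) ** A) *v x s" for n s
  have sum_eq: "(r n has_integral
      (\<Sum>k<Suc n. (\<Phi> (h n * real k) ** B) *v (m (h n * real (Suc k)) - m (h n * real k))) - x t) {0..t}" for n
  proof -
    define \<tau> where "\<tau> k = h n * real k" for k
    have \<tau>: "0 \<le> \<tau> k" "\<tau> k \<le> \<tau> (Suc k)" for k
      using h[of n] by (auto simp: \<tau>_def)
    have \<tau>_le: "\<tau> (Suc k) \<le> t" if "k < Suc n" for k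
      unfolding h_t[of n, symmetric] \<tau>_def using that h[of n] by (intro mult_left_mono) auto
    define J where "J k = integral {\<tau> k..\<tau> (Suc k)} (\<lambda>u. A *v x u)" for k
    define I where "I k = (\<Phi> (\<tau> k) - \<Phi> (\<tau> (Suc k))) *v x (\<tau> (Suc k)) - \<Phi> (\<tau> k) *v J k" for k
    have "(r n has_integral (\<Sum>k<Suc n. I k)) {0..h n * real (Suc n)}"
    proof (rule has_integral_grid)
      fix k assume k: "k < Suc n"
      have "((\<lambda>s. - (\<Phi> s ** A)) has_integral \<Phi> (\<tau> (Suc k)) - \<Phi> (\<tau> k)) {\<tau> k..\<tau> (Suc k)}"
        by (rule fundamental_theorem_of_calculus[OF \<tau>(2)]) (rule has_vector_derivative_at_within[OF \<Phi>'])
      from has_integral_neg[OF this]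
      have "((\<lambda>s. \<Phi> s ** A) has_integral \<Phi> (\<tau> k) - \<Phi> (\<tau> (Suc k))) {\<tau> k..\<tau> (Suc k)}" by simp
      from has_integral_linear[OF this vec_lin(1)]
      have 1: "((\<lambda>s. (\<Phi> s ** A) *v x (\<tau> (Suc k))) has_integral
          (\<Phi> (\<tau> k) - \<Phi> (\<tau> (Suc k))) *v x (\<tau> (Suc k))) {\<tau> k..\<tau> (Suc k)}"
        by (simp add: o_def)
      have "((\<lambda>u. A *v x u) has_integral J k) {\<tau> k..\<tau> (Suc k)}"
        unfolding J_def by (intro integrable_integral Ax_int \<tau> \<tau>_le k)
      from has_integral_linear[OF this vec_lin(2)]
      have 2: "((\<lambda>s. (\<Phi> (\<tau> k) ** A) *v x s) has_integral \<Phi> (\<tau> k) *v J k) {\<tau> k..\<tau> (Suc k)}"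
        by (simp add: o_def matrix_vector_mul_assoc)
      show "((\<lambda>s. (\<Phi> s ** A) *v x (\<tau> (Suc k)) - (\<Phi> (\<tau> k) ** A) *v x s) has_integral I k)
          {h n * real k..h n * real (Suc k)}"
        using has_integral_diff[OF 1 2] by (simp only: I_def \<tau>_def)
    qed (use h[of n] in \<open>auto simp: r_def grid_eq \<tau>_def simp del: of_nat_Suc\<close>)
    then have "(r n has_integral (\<Sum>k<Suc n. I k)) {0..t}" by (simp only: h_t)
    moreover have "I k = (\<Phi> (\<tau> k) ** B) *v (m (\<tau> (Suc k)) - m (\<tau> k))
        - (\<Phi> (\<tau> (Suc k)) *v x (\<tau> (Suc k)) - \<Phi> (\<tau> k) *v x (\<tau> k))" if k: "k < Suc n" for k
    proof -
      define Y where "Y s = integral {0..s} (\<lambda>u. A *v x u)" for s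
      have "Y (\<tau> k) + J k = Y (\<tau> (Suc k))"
        unfolding J_def Y_def using \<tau> \<tau>_le[OF k] by (intro Henstock_Kurzweil_Integration.integral_combine Ax_int) auto
      then have J: "J k = Y (\<tau> (Suc k)) - Y (\<tau> k)" by (simp add: algebra_simps)
      have Y: "x s = Y s + B *v (m s - m 0)" if "s \<ge> 0" for s
        unfolding Y_def by (rule eq[OF that])
      have "B *v (m (\<tau> (Suc k)) - m (\<tau> k)) = x (\<tau> (Suc k)) - x (\<tau> k) - J k"
        by (simp add: J Y[OF \<tau>(1)] matrix_vector_mult_diff_distrib)
      then have "(\<Phi> (\<tau> k) ** B) *v (m (\<tau> (Suc k)) - m (\<tau> k)) = \<Phi> (\<tau> k) *v (x (\<tau> (Suc k)) - x (\<tau> k) - J k)"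
        by (simp only: matrix_vector_mul_assoc[symmetric])
      then show ?thesis
        by (simp add: I_def matrix_vector_mult_diff_distrib matrix_vector_mult_diff_rdistrib)
    qed
    then have "(\<Sum>k<Suc n. I k) = (\<Sum>k<Suc n. (\<Phi> (\<tau> k) ** B) *v (m (\<tau> (Suc k)) - m (\<tau> k)))
        - (\<Sum>k<Suc n. \<Phi> (\<tau> (Suc k)) *v x (\<tau> (Suc k)) - \<Phi> (\<tau> k) *v x (\<tau> k))"
      by (simp only: sum_subtractf[symmetric]) (rule sum.cong, auto)
    moreover have "(\<Sum>k<Suc n. \<Phi> (\<tau> (Suc k)) *v x (\<tau> (Suc k)) - \<Phi> (\<tau> k) *v x (\<tau> k)) = x t"
      using sum_lessThan_telescope[of "\<lambda>k. \<Phi> (\<tau> k) *v x (\<tau> k)" "Suc n"]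
      by (simp only: \<tau>_def h_t) (simp add: \<Phi>_def matrix_exp_0 x0)
    ultimately show ?thesis by (simp only: \<tau>_def)
  qed
  have bound: "norm (r n s) \<le> R * K * c + R * K * c" if s: "s \<in> {0..t}" for n s
  proof -
    have "norm ((\<Phi> u ** A) *v x v) \<le> R * K * c" if "u \<in> {0..t}" "v \<in> {0..2*t}" for u v
    proof -
      have "norm ((\<Phi> u ** A) *v x v) \<le> norm (\<Phi> u ** A) * norm (x v) * c" by (rule c)
      also have "\<dots> \<le> R * K * c"
        using R[OF that(1)] K[OF that(2)] c(1) order_trans[OF norm_ge_zero R[OF that(1)]]
        by (intro mult_right_mono mult_mono) simp_all
      finally show ?thesis .
    qed
    note b = this
    show ?thesis
      unfolding r_def using s grid_bounds[OF h[of n], of s] h_le[of n] prev_grid_nonneg[OF h[of n], of s]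
      by (intro order_trans[OF norm_triangle_ineq4] add_mono b) auto
  qed
  have lim: "(\<lambda>n. r n s) \<longlonglongrightarrow> 0" if s: "s \<in> {0..t}" for s
  proof -
    have 1: "(\<lambda>n. x (next_grid (h n) s)) \<longlonglongrightarrow> x s"
      unfolding h_def by (rule filterlim_compose[OF right_cont next_grid_tendsto]) (use s t in auto)
    have "(\<lambda>n. \<Phi> (prev_grid (h n) s) ** A) \<longlonglongrightarrow> \<Phi> s ** A"
      unfolding h_def
      by (rule continuous_on_tendsto_compose[OF \<Phi>A_cont[of UNIV] prev_grid_tendsto]) (use t in auto)
    then have "(\<lambda>n. r n s) \<longlonglongrightarrow> (\<Phi> s ** A) *v x s - (\<Phi> s ** A) *v x s"
      unfolding r_def
      by (intro tendsto_diff bounded_linear.tendsto[OF vec_lin(1)] bounded_linear.tendsto[OF vec_lin(2)] 1)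
    then show ?thesis by simp
  qed
  have "(\<lambda>n. integral {0..t} (r n)) \<longlonglongrightarrow> integral {0..t} (\<lambda>_. 0)"
    by (rule dominated_convergence(2)[of r "{0..t}" "\<lambda>_. R * K * c + R * K * c" "\<lambda>_. 0",
          OF has_integral_integrable[OF sum_eq] _ bound lim]) (simp_all add: integrable_const_ivl)
  then have "(\<lambda>n. (\<Sum>k<Suc n. (\<Phi> (h n * real k) ** B) *v (m (h n * real (Suc k)) - m (h n * real k))) - x t) \<longlonglongrightarrow> 0"
    using integral_unique[OF sum_eq] by (simp del: of_nat_Suc sum.lessThan_Suc)
  then show ?thesis
    unfolding \<Phi>_def by (rule LIM_zero_cancel)
qed

section \<open>Second moments of sums of Levy increments\<close>

lemma borel_measurable_matrix_vector_mult:
  fixes X :: "real^'n^'m"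
  assumes "f \<in> borel_measurable N"
  shows "(\<lambda>\<omega>. X *v f \<omega>) \<in> borel_measurable N"
  by (rule measurable_compose[OF assms borel_measurable_continuous_onI])
     (intro linear_continuous_on matrix_vector_mul_bounded_linear)

text \<open>Cauchy's functional equation: nonnegativity makes an additive function monotone, so squeezing
  \<open>n t\<close> between consecutive integers leaves an error that is bounded in \<open>n\<close>.\<close>

lemma additive_nonneg_linear:
  fixes f :: "real \<Rightarrow> real"
  assumes add: "\<And>s t. s \<ge> 0 \<Longrightarrow> t \<ge> 0 \<Longrightarrow> f (s + t) = f s + f t"
    and nonneg: "\<And>t. t \<ge> 0 \<Longrightarrow> f t \<ge> 0" and t: "t \<ge> 0"
  shows "f t = t * f 1"
proof -
  have mono: "f s \<le> f u" if "0 \<le> s" "s \<le> u" for s u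
    using add[of s "u - s"] nonneg[of "u - s"] that by simp
  have f0: "f 0 = 0" using add[of 0 0] by simp
  have mult: "f (real n * s) = real n * f s" if "s \<ge> 0" for n s
  proof (induction n)
    case (Suc n)
    have "f (real (Suc n) * s) = f (real n * s + s)" by (simp add: algebra_simps)
    also have "\<dots> = f (real n * s) + f s" using that by (intro add) auto
    finally show ?case using Suc by (simp add: algebra_simps)
  qed (simp add: f0)
  have bound: "real n * \<bar>f t - t * f 1\<bar> \<le> f 1" for n
  proof -
    define m where "m = nat \<lfloor>real n * t\<rfloor>"
    have m: "real m \<le> real n * t" "real n * t \<le> real (Suc m)"
      using t by (auto simp: m_def) (use floor_correct[of "real n * t"] in linarith)+
    have "f (real m * 1) \<le> f (real n * t)" "f (real n * t) \<le> f (real (Suc m) * 1)"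
      using m t by (auto intro!: mono)
    then have 1: "real m * f 1 \<le> real n * f t" "real n * f t \<le> real (Suc m) * f 1"
      using t by (simp_all only: mult zero_le_one)
    have "real m * f 1 \<le> real n * t * f 1" "real n * t * f 1 \<le> real (Suc m) * f 1"
      using m nonneg[of 1] by (auto intro!: mult_right_mono)
    with 1 have "\<bar>real n * f t - real n * t * f 1\<bar> \<le> f 1" by (simp add: algebra_simps abs_le_iff)
    also have "real n * f t - real n * t * f 1 = real n * (f t - t * f 1)" by (simp add: algebra_simps)
    finally show ?thesis by (simp add: abs_mult)
  qed
  have "\<not> 0 < \<bar>f t - t * f 1\<bar>"
  proof
    assume "0 < \<bar>f t - t * f 1\<bar>"
    then obtain n :: nat where "f 1 < real n * \<bar>f t - t * f 1\<bar>"
      using reals_Archimedean3 by blast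
    with bound[of n] show False by simp
  qed
  then show ?thesis by simp
qed

lemma (in prob_space) second_moment_indep_sum:
  fixes Y :: "'i \<Rightarrow> 'a \<Rightarrow> real"
  assumes I: "finite I" and indep: "indep_vars (\<lambda>_. borel) Y I"
    and int: "\<And>i. i \<in> I \<Longrightarrow> integrable M (Y i)"
    and int2: "\<And>i. i \<in> I \<Longrightarrow> integrable M (\<lambda>\<omega>. (Y i \<omega>)\<^sup>2)"
    and mean: "\<And>i. i \<in> I \<Longrightarrow> expectation (Y i) = 0"
  shows "integrable M (\<lambda>\<omega>. (\<Sum>i\<in>I. Y i \<omega>)\<^sup>2)"
    and "expectation (\<lambda>\<omega>. (\<Sum>i\<in>I. Y i \<omega>)\<^sup>2) = (\<Sum>i\<in>I. expectation (\<lambda>\<omega>. (Y i \<omega>)\<^sup>2))"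
proof -
  have pair: "integrable M (\<lambda>\<omega>. Y i \<omega> * Y j \<omega>)
      \<and> expectation (\<lambda>\<omega>. Y i \<omega> * Y j \<omega>) = (if i = j then expectation (\<lambda>\<omega>. (Y i \<omega>)\<^sup>2) else 0)"
    if "i \<in> I" "j \<in> I" for i j
  proof (cases "i = j")
    case True
    then show ?thesis using int2[OF that(1)] by (simp add: power2_eq_square)
  next
    case False
    have ij: "indep_vars (\<lambda>_. borel) Y {i, j}"
      by (rule indep_vars_subset[OF indep]) (use that in auto)
    have "\<And>l. l \<in> {i, j} \<Longrightarrow> integrable M (Y l)" using int that by auto
    from indep_vars_integrable[OF _ ij this] indep_vars_lebesgue_integral[OF _ ij this] False
    show ?thesis using mean[OF that(1)] by simp
  qed
  have eq: "(\<lambda>\<omega>. (\<Sum>i\<in>I. Y i \<omega>)\<^sup>2) = (\<lambda>\<omega>. \<Sum>i\<in>I. \<Sum>j\<in>I. Y i \<omega> * Y j \<omega>)"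
    by (simp add: power2_eq_square sum_product)
  show "integrable M (\<lambda>\<omega>. (\<Sum>i\<in>I. Y i \<omega>)\<^sup>2)"
    unfolding eq using pair by (intro Bochner_Integration.integrable_sum) auto
  have "expectation (\<lambda>\<omega>. (\<Sum>i\<in>I. Y i \<omega>)\<^sup>2) = (\<Sum>i\<in>I. \<Sum>j\<in>I. expectation (\<lambda>\<omega>. Y i \<omega> * Y j \<omega>))"
    unfolding eq using pair
    by (subst Bochner_Integration.integral_sum) (auto intro!: sum.cong Bochner_Integration.integral_sum Bochner_Integration.integrable_sum)
  also have "\<dots> = (\<Sum>i\<in>I. expectation (\<lambda>\<omega>. (Y i \<omega>)\<^sup>2))"
    using pair I by (intro sum.cong) simp_all
  finally show "expectation (\<lambda>\<omega>. (\<Sum>i\<in>I. Y i \<omega>)\<^sup>2) = (\<Sum>i\<in>I. expectation (\<lambda>\<omega>. (Y i \<omega>)\<^sup>2))" .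
qed

text \<open>Nonnegativity of the variance.\<close>

lemma (in prob_space) nn_integral_le_sqrt_second_moment:
  fixes X :: "'a \<Rightarrow> real"
  assumes [measurable]: "X \<in> borel_measurable M" and nonneg: "\<And>\<omega>. X \<omega> \<ge> 0"
    and le: "(\<integral>\<^sup>+\<omega>. ennreal ((X \<omega>)\<^sup>2) \<partial>M) \<le> ennreal K" and K: "K \<ge> 0"
  shows "(\<integral>\<^sup>+\<omega>. ennreal (X \<omega>) \<partial>M) \<le> ennreal (sqrt K)"
proof -
  have int2: "integrable M (\<lambda>\<omega>. (X \<omega>)\<^sup>2)"
    using le by (intro integrableI_bounded) (auto intro: le_less_trans simp: less_top[symmetric] ennreal_power[symmetric] top_unique)
  have int: "integrable M X"
    by (rule square_integrable_imp_integrable[OF _ int2]) simp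
  have "ennreal (expectation (\<lambda>\<omega>. (X \<omega>)\<^sup>2)) \<le> ennreal K"
    using le by (subst nn_integral_eq_integral[symmetric, OF int2]) auto
  then have "expectation (\<lambda>\<omega>. (X \<omega>)\<^sup>2) \<le> K"
    using K by (simp add: ennreal_le_iff)
  moreover have "(expectation X)\<^sup>2 \<le> expectation (\<lambda>\<omega>. (X \<omega>)\<^sup>2)"
    using variance_eq[OF int int2] variance_positive[of X] by simp
  ultimately have "expectation X \<le> sqrt K"
    by (intro real_le_rsqrt) simp
  moreover have "(\<integral>\<^sup>+\<omega>. ennreal (X \<omega>) \<partial>M) = ennreal (expectation X)"
    using nonneg by (intro nn_integral_eq_integral int) auto
  ultimately show ?thesis by (simp add: ennreal_leI)
qed

context prob_space
begin

context
  fixes L :: "real \<Rightarrow> 'a \<Rightarrow> real^'m" and QM :: "real^'m^'m"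
  assumes levy: "levy_process M L" and square: "square_integrable_process M L"
    and mean: "mean_zero_process M L" and QM: "QM = covariance_at_one M L"
begin

lemma levy_measurable: "t \<ge> 0 \<Longrightarrow> L t \<in> borel_measurable M"
  using levy by (simp add: levy_process_def)

lemma levy_square_integrable: "t \<ge> 0 \<Longrightarrow> integrable M (\<lambda>\<omega>. (norm (L t \<omega>))\<^sup>2)"
  using square by (simp add: square_integrable_process_def)

lemma levy_integrable:
  assumes "t \<ge> 0" shows "integrable M (L t)"
proof -
  note [measurable] = levy_measurable[OF assms]
  have "integrable M (\<lambda>\<omega>. norm (L t \<omega>))"
    by (rule square_integrable_imp_integrable) (use levy_square_integrable[OF assms] in simp_all)
  then show ?thesis by (simp add: integrable_norm_iff)
qed

lemma levy_increment_moments: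
  assumes "s \<ge> 0" "t \<ge> 0"
  shows "integrable M (\<lambda>\<omega>. v \<bullet> (L t \<omega> - L s \<omega>))"
    and "expectation (\<lambda>\<omega>. v \<bullet> (L t \<omega> - L s \<omega>)) = 0"
    and "integrable M (\<lambda>\<omega>. (v \<bullet> (L t \<omega> - L s \<omega>))\<^sup>2)"
proof -
  note [measurable] = levy_measurable[OF assms(1)] levy_measurable[OF assms(2)]
  note int = levy_integrable[OF assms(1)] levy_integrable[OF assms(2)]
  show "integrable M (\<lambda>\<omega>. v \<bullet> (L t \<omega> - L s \<omega>))" using int by simp
  show "expectation (\<lambda>\<omega>. v \<bullet> (L t \<omega> - L s \<omega>)) = 0"
    using int mean assms by (simp add: mean_zero_process_def)
  show "integrable M (\<lambda>\<omega>. (v \<bullet> (L t \<omega> - L s \<omega>))\<^sup>2)"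
  proof (rule Bochner_Integration.integrable_bound)
    show "integrable M (\<lambda>\<omega>. (norm v)\<^sup>2 * (2 * (norm (L t \<omega>))\<^sup>2 + 2 * (norm (L s \<omega>))\<^sup>2))"
      using assms by (intro integrable_mult_right Bochner_Integration.integrable_add levy_square_integrable)
    show "AE \<omega> in M. norm ((v \<bullet> (L t \<omega> - L s \<omega>))\<^sup>2)
        \<le> norm ((norm v)\<^sup>2 * (2 * (norm (L t \<omega>))\<^sup>2 + 2 * (norm (L s \<omega>))\<^sup>2))"
    proof (intro AE_I2)
      fix \<omega>
      have "\<bar>v \<bullet> (L t \<omega> - L s \<omega>)\<bar> \<le> norm v * (norm (L t \<omega>) + norm (L s \<omega>))"
        by (rule order_trans[OF Cauchy_Schwarz_ineq2]) (intro mult_left_mono norm_triangle_ineq4 norm_ge_zero)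
      then have "\<bar>v \<bullet> (L t \<omega> - L s \<omega>)\<bar>\<^sup>2 \<le> (norm v * (norm (L t \<omega>) + norm (L s \<omega>)))\<^sup>2"
        by (rule power_mono) simp
      also have "\<dots> = (norm v)\<^sup>2 * (norm (L t \<omega>) + norm (L s \<omega>))\<^sup>2" by (simp add: power_mult_distrib)
      also have "\<dots> \<le> (norm v)\<^sup>2 * (2 * (norm (L t \<omega>))\<^sup>2 + 2 * (norm (L s \<omega>))\<^sup>2)"
        using sum_squares_bound[of "norm (L t \<omega>)" "norm (L s \<omega>)"]
        by (intro mult_left_mono) (auto simp: power2_sum)
      finally show "norm ((v \<bullet> (L t \<omega> - L s \<omega>))\<^sup>2)
        \<le> norm ((norm v)\<^sup>2 * (2 * (norm (L t \<omega>))\<^sup>2 + 2 * (norm (L s \<omega>))\<^sup>2))" by simp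
    qed
  qed measurable
qed

lemma levy_increments_indep_sum:
  assumes grid: "0 \<le> \<tau> 0" "mono_on {..N} \<tau>"
  shows "integrable M (\<lambda>\<omega>. (\<Sum>k<N. a k \<bullet> (L (\<tau> (Suc k)) \<omega> - L (\<tau> k) \<omega>))\<^sup>2)"
    and "expectation (\<lambda>\<omega>. (\<Sum>k<N. a k \<bullet> (L (\<tau> (Suc k)) \<omega> - L (\<tau> k) \<omega>))\<^sup>2)
      = (\<Sum>k<N. expectation (\<lambda>\<omega>. (a k \<bullet> (L (\<tau> (Suc k)) \<omega> - L (\<tau> k) \<omega>))\<^sup>2))"
proof -
  have \<tau>: "0 \<le> \<tau> k" if "k \<le> N" for k
    using mono_onD[OF grid(2), of 0 k] grid(1) that by simp
  have "indep_vars (\<lambda>_. borel) (\<lambda>k \<omega>. L (\<tau> (Suc k)) \<omega> - L (\<tau> k) \<omega>) {..<N}"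
    using levy grid unfolding levy_process_def by blast
  then have indep: "indep_vars (\<lambda>_. borel) (\<lambda>k \<omega>. a k \<bullet> (L (\<tau> (Suc k)) \<omega> - L (\<tau> k) \<omega>)) {..<N}"
    by (rule indep_vars_compose2[where Y = "\<lambda>k x. a k \<bullet> x"]) measurable
  show "integrable M (\<lambda>\<omega>. (\<Sum>k<N. a k \<bullet> (L (\<tau> (Suc k)) \<omega> - L (\<tau> k) \<omega>))\<^sup>2)"
    and "expectation (\<lambda>\<omega>. (\<Sum>k<N. a k \<bullet> (L (\<tau> (Suc k)) \<omega> - L (\<tau> k) \<omega>))\<^sup>2)
      = (\<Sum>k<N. expectation (\<lambda>\<omega>. (a k \<bullet> (L (\<tau> (Suc k)) \<omega> - L (\<tau> k) \<omega>))\<^sup>2))"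
    by (rule second_moment_indep_sum[OF finite_lessThan indep]; use \<tau> in \<open>auto intro: levy_increment_moments\<close>)+
qed

lemma levy_increment_stationary:
  assumes "s \<ge> 0" "h \<ge> 0"
  shows "expectation (\<lambda>\<omega>. (v \<bullet> (L (s + h) \<omega> - L s \<omega>))\<^sup>2) = expectation (\<lambda>\<omega>. (v \<bullet> (L h \<omega> - L 0 \<omega>))\<^sup>2)"
proof -
  note [measurable] = levy_measurable[of s] levy_measurable[of h] levy_measurable[of 0] levy_measurable[of "s + h"]
  have "distr M borel (\<lambda>\<omega>. L (s + h) \<omega> - L s \<omega>) = distr M borel (\<lambda>\<omega>. L h \<omega> - L 0 \<omega>)"
    using levy assms by (simp add: levy_process_def)
  then have "(\<integral>x. (v \<bullet> x)\<^sup>2 \<partial>distr M borel (\<lambda>\<omega>. L (s + h) \<omega> - L s \<omega>))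
      = (\<integral>x. (v \<bullet> x)\<^sup>2 \<partial>distr M borel (\<lambda>\<omega>. L h \<omega> - L 0 \<omega>))" by simp
  then show ?thesis using assms by (simp add: integral_distr)
qed

lemma levy_variance_at_one:
  "expectation (\<lambda>\<omega>. (v \<bullet> (L 1 \<omega> - L 0 \<omega>))\<^sup>2) = v \<bullet> (QM *v v)"
proof -
  note [measurable] = levy_measurable[of 0, simplified] levy_measurable[of 1, simplified]
  have int: "integrable M (\<lambda>\<omega>. L 1 \<omega> $ i * L 1 \<omega> $ j)" for i j
  proof (rule Bochner_Integration.integrable_bound)
    show "integrable M (\<lambda>\<omega>. (norm (L 1 \<omega>))\<^sup>2)" by (rule levy_square_integrable) simp
    show "random_variable borel (\<lambda>\<omega>. L 1 \<omega> $ i * L 1 \<omega> $ j)"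
      unfolding cart_eq_inner_axis by measurable
    show "AE \<omega> in M. norm (L 1 \<omega> $ i * L 1 \<omega> $ j) \<le> norm ((norm (L 1 \<omega>))\<^sup>2)"
      by (intro AE_I2) (auto simp: abs_mult power2_eq_square component_le_norm_cart intro!: mult_mono)
  qed
  have "AE \<omega> in M. L 0 \<omega> = 0" using levy by (simp add: levy_process_def)
  then have "expectation (\<lambda>\<omega>. (v \<bullet> (L 1 \<omega> - L 0 \<omega>))\<^sup>2) = expectation (\<lambda>\<omega>. (v \<bullet> L 1 \<omega>)\<^sup>2)"
    by (intro integral_cong_AE) auto
  also have "\<dots> = expectation (\<lambda>\<omega>. \<Sum>i\<in>UNIV. \<Sum>j\<in>UNIV. (v $ i * v $ j) * (L 1 \<omega> $ i * L 1 \<omega> $ j))"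
    by (simp add: inner_vec_def power2_eq_square sum_product mult_ac)
  also have "\<dots> = (\<Sum>i\<in>UNIV. \<Sum>j\<in>UNIV. (v $ i * v $ j) * QM $ i $ j)"
    using int by (simp add: Bochner_Integration.integral_sum QM covariance_at_one_def)
  also have "\<dots> = v \<bullet> (QM *v v)"
    by (simp add: inner_vec_def matrix_vector_mult_def sum_distrib_left mult_ac)
  finally show ?thesis .
qed

text \<open>Stationarity and independence of the increments make \<open>h \<mapsto> E (v \<bullet> (L h - L 0))\<^sup>2\<close> additive, and an
  additive nonnegative function is linear.\<close>

lemma levy_increment_variance:
  assumes "0 \<le> s" "s \<le> t"
  shows "expectation (\<lambda>\<omega>. (v \<bullet> (L t \<omega> - L s \<omega>))\<^sup>2) = (t - s) * (v \<bullet> (QM *v v))"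
proof -
  define \<psi> where "\<psi> h = expectation (\<lambda>\<omega>. (v \<bullet> (L h \<omega> - L 0 \<omega>))\<^sup>2)" for h
  have add: "\<psi> (s + h) = \<psi> s + \<psi> h" if "s \<ge> 0" "h \<ge> 0" for s h
  proof -
    define \<tau> :: "nat \<Rightarrow> real" where "\<tau> k = (if k = 0 then 0 else if k = 1 then s else s + h)" for k
    have "mono_on {..2} \<tau>" using that by (auto simp: mono_on_def \<tau>_def)
    from levy_increments_indep_sum(2)[OF _ this, of "\<lambda>_. v"]
    have "expectation (\<lambda>\<omega>. (v \<bullet> (L s \<omega> - L 0 \<omega>) + v \<bullet> (L (s + h) \<omega> - L s \<omega>))\<^sup>2)
        = \<psi> s + expectation (\<lambda>\<omega>. (v \<bullet> (L (s + h) \<omega> - L s \<omega>))\<^sup>2)"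
      by (simp add: \<tau>_def numeral_2_eq_2 \<psi>_def)
    moreover have "v \<bullet> (L s \<omega> - L 0 \<omega>) + v \<bullet> (L (s + h) \<omega> - L s \<omega>) = v \<bullet> (L (s + h) \<omega> - L 0 \<omega>)" for \<omega>
      by (simp add: inner_diff_right)
    ultimately show ?thesis
      using levy_increment_stationary[OF that] by (simp add: \<psi>_def)
  qed
  have "\<psi> (t - s) = (t - s) * \<psi> 1"
    using assms by (intro additive_nonneg_linear add) (auto simp: \<psi>_def)
  moreover have "expectation (\<lambda>\<omega>. (v \<bullet> (L t \<omega> - L s \<omega>))\<^sup>2) = \<psi> (t - s)"
    using levy_increment_stationary[of s "t - s" v] assms by (simp add: \<psi>_def)
  ultimately show ?thesis by (simp add: \<psi>_def levy_variance_at_one)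
qed

lemma covariance_psd: "0 \<le> v \<bullet> (QM *v v)"
  unfolding levy_variance_at_one[symmetric] by (intro Bochner_Integration.integral_nonneg) simp

lemma covariance_symmetric: "transpose QM = QM"
  by (simp add: QM covariance_at_one_def transpose_def mult.commute)

text \<open>The Ito isometry for step functions.\<close>

lemma levy_weighted_sum_second_moment:
  fixes F :: "nat \<Rightarrow> real^'m^'p"
  assumes grid: "0 \<le> \<tau> 0" "mono_on {..N} \<tau>"
  shows "integrable M (\<lambda>\<omega>. (norm (\<Sum>k<N. F k *v (L (\<tau> (Suc k)) \<omega> - L (\<tau> k) \<omega>)))\<^sup>2)"
    and "expectation (\<lambda>\<omega>. (norm (\<Sum>k<N. F k *v (L (\<tau> (Suc k)) \<omega> - L (\<tau> k) \<omega>)))\<^sup>2)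
      = (\<Sum>k<N. (\<tau> (Suc k) - \<tau> k) * trace (F k ** QM ** transpose (F k)))"
proof -
  have \<tau>: "0 \<le> \<tau> k" if "k \<le> N" for k
    using mono_onD[OF grid(2), of 0 k] grid(1) that by simp
  have \<tau>_le: "\<tau> k \<le> \<tau> (Suc k)" if "k < N" for k
    using mono_onD[OF grid(2), of k "Suc k"] that by simp
  have norm_eq: "(norm (\<Sum>k<N. F k *v (L (\<tau> (Suc k)) \<omega> - L (\<tau> k) \<omega>)))\<^sup>2
      = (\<Sum>i\<in>UNIV. (\<Sum>k<N. F k $ i \<bullet> (L (\<tau> (Suc k)) \<omega> - L (\<tau> k) \<omega>))\<^sup>2)" for \<omega>
    unfolding power2_norm_eq_inner
    by (simp add: inner_vec_def[of "sum _ _"] matrix_mult_dot power2_eq_square)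
  note row = levy_increments_indep_sum[OF grid]
  show "integrable M (\<lambda>\<omega>. (norm (\<Sum>k<N. F k *v (L (\<tau> (Suc k)) \<omega> - L (\<tau> k) \<omega>)))\<^sup>2)"
    unfolding norm_eq by (intro Bochner_Integration.integrable_sum row(1))
  have "expectation (\<lambda>\<omega>. (norm (\<Sum>k<N. F k *v (L (\<tau> (Suc k)) \<omega> - L (\<tau> k) \<omega>)))\<^sup>2)
      = (\<Sum>i\<in>UNIV. \<Sum>k<N. expectation (\<lambda>\<omega>. (F k $ i \<bullet> (L (\<tau> (Suc k)) \<omega> - L (\<tau> k) \<omega>))\<^sup>2))"
    unfolding norm_eq by (subst Bochner_Integration.integral_sum) (simp_all only: row)
  also have "\<dots> = (\<Sum>i\<in>UNIV. \<Sum>k<N. (\<tau> (Suc k) - \<tau> k) * (F k $ i \<bullet> (QM *v (F k $ i))))"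
    by (intro sum.cong refl levy_increment_variance) (use \<tau> \<tau>_le in auto)
  also have "\<dots> = (\<Sum>k<N. (\<tau> (Suc k) - \<tau> k) * trace (F k ** QM ** transpose (F k)))"
    by (subst sum.swap) (simp add: trace_congruence sum_distrib_left)
  finally show "expectation (\<lambda>\<omega>. (norm (\<Sum>k<N. F k *v (L (\<tau> (Suc k)) \<omega> - L (\<tau> k) \<omega>)))\<^sup>2)
      = (\<Sum>k<N. (\<tau> (Suc k) - \<tau> k) * trace (F k ** QM ** transpose (F k)))" .
qed

text \<open>Fatou's lemma for the approximating sums of \<open>variation_of_constants_limit\<close>, whose second moments are
  Riemann sums.  The inequality suffices and avoids joint measurability of the solution in time and
  outcome.\<close>

lemma output_difference_second_moment_le:
  fixes A :: "real^'n^'n" and D :: "real^'k^'k" and B :: "real^'m^'n" and B1 :: "real^'m^'k"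
    and C :: "real^'n^'p" and C1 :: "real^'k^'p"
  assumes x: "linear_sde_solution M A B L x" and z: "linear_sde_solution M D B1 L z"
    and t: "t \<ge> 0"
  defines "F \<equiv> \<lambda>s. C ** matrix_exp (s *\<^sub>R A) ** B - C1 ** matrix_exp (s *\<^sub>R D) ** B1"
  shows "(\<integral>\<^sup>+\<omega>. ennreal ((norm (C *v x t \<omega> - C1 *v z t \<omega>))\<^sup>2) \<partial>M)
    \<le> ennreal (integral {0..t} (\<lambda>s. trace (F s ** QM ** transpose (F s))))"
proof (cases "t = 0")
  case True
  have "AE \<omega> in M. x t \<omega> = 0" "AE \<omega> in M. z t \<omega> = 0"
    using x z True by (simp_all add: linear_sde_solution_def)
  then have "AE \<omega> in M. ennreal ((norm (C *v x t \<omega> - C1 *v z t \<omega>))\<^sup>2) = 0"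
    by eventually_elim simp
  then have "(\<integral>\<^sup>+\<omega>. ennreal ((norm (C *v x t \<omega> - C1 *v z t \<omega>))\<^sup>2) \<partial>M) = (\<integral>\<^sup>+\<omega>. 0 \<partial>M)"
    by (rule nn_integral_cong_AE)
  then show ?thesis by simp
next
  case False
  then have t: "t > 0" using t by simp
  define h where "h n = t / real (Suc n)" for n
  have h: "h n > 0" and h_t: "h n * real (Suc n) = t" for n
    using t by (auto simp: h_def field_simps simp del: of_nat_Suc)
  define \<phi> where "\<phi> s = trace (F s ** QM ** transpose (F s))" for s
  have \<phi>_nonneg: "\<phi> s \<ge> 0" for s
    unfolding \<phi>_def trace_congruence by (intro sum_nonneg covariance_psd)
  have exp_cont: "continuous_on S (\<lambda>s. matrix_exp (s *\<^sub>R X))" for S and X :: "real^'i^'i"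
    by (rule has_vector_derivative_imp_continuous_on[OF matrix_exp_deriv_left])
  have F_cont: "continuous_on S F" for S
    unfolding F_def
    by (intro continuous_on_diff exp_cont continuous_on_const
        bounded_bilinear.continuous_on[OF bounded_bilinear_matrix_mult])
  have \<phi>_cont: "continuous_on S \<phi>" for S
    unfolding \<phi>_def
    by (intro bounded_linear.continuous_on[OF bounded_linear_trace]
        bounded_bilinear.continuous_on[OF bounded_bilinear_matrix_mult] continuous_on_const F_cont
        bounded_linear.continuous_on[OF bounded_linear_transpose])
  define S where "S n \<omega> = (\<Sum>k<Suc n. F (t - h n * real k) *v
      (L (h n * real (Suc k)) \<omega> - L (h n * real k) \<omega>))" for n \<omega>
  have S_lim: "AE \<omega> in M. (\<lambda>n. S n \<omega>) \<longlonglongrightarrow> C *v x t \<omega> - C1 *v z t \<omega>"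
  proof -
    have "AE \<omega> in M. cadlag (\<lambda>s. x s \<omega>)" "AE \<omega> in M. x 0 \<omega> = 0"
      "AE \<omega> in M. \<forall>s\<ge>0. x s \<omega> = x 0 \<omega> + integral {0..s} (\<lambda>u. A *v x u \<omega>) + B *v (L s \<omega> - L 0 \<omega>)"
      "AE \<omega> in M. cadlag (\<lambda>s. z s \<omega>)" "AE \<omega> in M. z 0 \<omega> = 0"
      "AE \<omega> in M. \<forall>s\<ge>0. z s \<omega> = z 0 \<omega> + integral {0..s} (\<lambda>u. D *v z u \<omega>) + B1 *v (L s \<omega> - L 0 \<omega>)"
      using x z unfolding linear_sde_solution_def by blast+
    then show ?thesis
    proof eventually_elim
      case (elim \<omega>)
      have "(\<lambda>n. \<Sum>k<Suc n. (matrix_exp ((t - h n * real k) *\<^sub>R A) ** B) *v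
          (L (h n * real (Suc k)) \<omega> - L (h n * real k) \<omega>)) \<longlonglongrightarrow> x t \<omega>"
        unfolding h_def
        by (rule variation_of_constants_limit[OF elim(1,2) t, where m = "\<lambda>s. L s \<omega>"])
           (metis elim(2,3) add_0)
      then have 1: "(\<lambda>n. C *v (\<Sum>k<Suc n. (matrix_exp ((t - h n * real k) *\<^sub>R A) ** B) *v
          (L (h n * real (Suc k)) \<omega> - L (h n * real k) \<omega>))) \<longlonglongrightarrow> C *v x t \<omega>"
        by (rule bounded_linear.tendsto[OF matrix_vector_mul_bounded_linear])
      have "(\<lambda>n. \<Sum>k<Suc n. (matrix_exp ((t - h n * real k) *\<^sub>R D) ** B1) *v
          (L (h n * real (Suc k)) \<omega> - L (h n * real k) \<omega>)) \<longlonglongrightarrow> z t \<omega>"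
        unfolding h_def
        by (rule variation_of_constants_limit[OF elim(4,5) t, where m = "\<lambda>s. L s \<omega>"])
           (metis elim(5,6) add_0)
      then have 2: "(\<lambda>n. C1 *v (\<Sum>k<Suc n. (matrix_exp ((t - h n * real k) *\<^sub>R D) ** B1) *v
          (L (h n * real (Suc k)) \<omega> - L (h n * real k) \<omega>))) \<longlonglongrightarrow> C1 *v z t \<omega>"
        by (rule bounded_linear.tendsto[OF matrix_vector_mul_bounded_linear])
      have "S n \<omega> = C *v (\<Sum>k<Suc n. (matrix_exp ((t - h n * real k) *\<^sub>R A) ** B) *v
          (L (h n * real (Suc k)) \<omega> - L (h n * real k) \<omega>))
        - C1 *v (\<Sum>k<Suc n. (matrix_exp ((t - h n * real k) *\<^sub>R D) ** B1) *v
          (L (h n * real (Suc k)) \<omega> - L (h n * real k) \<omega>))" for n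
        unfolding S_def F_def
        by (simp only: linear_sum[OF matrix_vector_mul_linear] matrix_vector_mult_diff_rdistrib
            sum_subtractf matrix_vector_mul_assoc matrix_mul_assoc)
      then show ?case using tendsto_diff[OF 1 2] by (simp only:)
    qed
  qed
  have moment: "(\<integral>\<^sup>+\<omega>. ennreal ((norm (S n \<omega>))\<^sup>2) \<partial>M) = ennreal (\<Sum>k<Suc n. h n * \<phi> (h n * real (Suc k)))" for n
  proof -
    define \<tau> where "\<tau> k = h n * real k" for k
    have \<tau>: "0 \<le> \<tau> 0" "mono_on {..Suc n} \<tau>"
      using h[of n] by (auto simp: \<tau>_def mono_on_def intro!: mult_left_mono)
    \<comment> \<open>The weight of the \<open>k\<close>-th increment is \<open>F (t - \<tau> k)\<close>, so reversing the order of summation gives a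
      right-endpoint sum of \<open>\<phi>\<close>.\<close>
    note sec = levy_weighted_sum_second_moment[OF \<tau>, of "\<lambda>k. F (t - \<tau> k)", folded \<phi>_def]
    have "(\<integral>\<^sup>+\<omega>. ennreal ((norm (S n \<omega>))\<^sup>2) \<partial>M)
        = ennreal (expectation (\<lambda>\<omega>. (norm (S n \<omega>))\<^sup>2))"
      using sec(1) by (intro nn_integral_eq_integral) (simp_all only: S_def \<tau>_def, simp)
    also have "expectation (\<lambda>\<omega>. (norm (S n \<omega>))\<^sup>2) = (\<Sum>k<Suc n. h n * \<phi> (t - \<tau> k))"
      using sec(2) by (simp only: S_def \<tau>_def) (simp add: algebra_simps)
    also have "\<dots> = (\<Sum>k<Suc n. h n * \<phi> (h n * real (Suc k)))"
    proof (subst sum.nat_diff_reindex[symmetric], rule sum.cong[OF refl])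
      fix k assume "k \<in> {..<Suc n}"
      then have "t - \<tau> (Suc n - Suc k) = h n * real (Suc k)"
        unfolding \<tau>_def h_t[of n, symmetric] by (simp add: of_nat_diff algebra_simps)
      then show "h n * \<phi> (t - \<tau> (Suc n - Suc k)) = h n * \<phi> (h n * real (Suc k))" by simp
    qed
    finally show ?thesis .
  qed
  have "bounded (\<phi> ` {0..2 * t})"
    by (intro compact_imp_bounded compact_continuous_image \<phi>_cont) simp
  then obtain K where K: "\<And>s. s \<in> {0..2 * t} \<Longrightarrow> norm (\<phi> s) \<le> K"
    unfolding bounded_iff by blast
  have "(\<phi> \<longlongrightarrow> \<phi> s) (at_right s)" for s
    by (rule tendsto_within_subset[of _ _ _ UNIV]) (use \<phi>_cont[of UNIV] in \<open>auto simp: continuous_on_def\<close>)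
  from right_endpoint_riemann_sum(2)[OF t this K]
  have "(\<lambda>n. \<Sum>k<Suc n. h n * \<phi> (h n * real (Suc k))) \<longlonglongrightarrow> integral {0..t} \<phi>"
    by (simp add: h_def)
  then have riemann: "(\<lambda>n. ennreal (\<Sum>k<Suc n. h n * \<phi> (h n * real (Suc k)))) \<longlonglongrightarrow> ennreal (integral {0..t} \<phi>)"
    by (rule tendsto_ennrealI)
  have [measurable]: "S n \<in> borel_measurable M" for n
  proof -
    have "(\<lambda>\<omega>. F (t - h n * real k) *v (L (h n * real (Suc k)) \<omega> - L (h n * real k) \<omega>)) \<in> borel_measurable M" for k
      using h[of n]
      by (intro borel_measurable_matrix_vector_mult borel_measurable_diff
          levy_measurable) auto
    then show ?thesis unfolding S_def[abs_def] by (intro borel_measurable_sum)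
  qed
  have "(\<integral>\<^sup>+\<omega>. ennreal ((norm (C *v x t \<omega> - C1 *v z t \<omega>))\<^sup>2) \<partial>M)
      = (\<integral>\<^sup>+\<omega>. liminf (\<lambda>n. ennreal ((norm (S n \<omega>))\<^sup>2)) \<partial>M)"
  proof (rule nn_integral_cong_AE)
    show "AE \<omega> in M. ennreal ((norm (C *v x t \<omega> - C1 *v z t \<omega>))\<^sup>2) = liminf (\<lambda>n. ennreal ((norm (S n \<omega>))\<^sup>2))"
      using S_lim
    proof eventually_elim
      case (elim \<omega>)
      have "(\<lambda>n. ennreal ((norm (S n \<omega>))\<^sup>2)) \<longlonglongrightarrow> ennreal ((norm (C *v x t \<omega> - C1 *v z t \<omega>))\<^sup>2)"
        by (intro tendsto_ennrealI tendsto_power tendsto_norm elim)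
      from lim_imp_Liminf[OF _ this] show ?case by simp
    qed
  qed
  also have "\<dots> \<le> liminf (\<lambda>n. \<integral>\<^sup>+\<omega>. ennreal ((norm (S n \<omega>))\<^sup>2) \<partial>M)"
    by (rule nn_integral_liminf) measurable
  also have "\<dots> = ennreal (integral {0..t} \<phi>)"
    unfolding moment by (rule lim_imp_Liminf[OF _ riemann]) simp
  finally show ?thesis by (simp only: \<phi>_def[abs_def])
qed

end

end

section \<open>The error bound\<close>

theorem theorem2p10:
  fixes \<Omega> :: "'w measure"
    and M :: "real \<Rightarrow> 'w \<Rightarrow> real^'m"
    and QM :: "real^'m^'m"
    and A P Q T \<Sigma> :: "real^('r::{finite,linorder} + 's::{finite,linorder})^('r + 's)"
    and B :: "real^'m^('r + 's)"
    and C :: "real^('r + 's)^'p"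
    and \<sigma> :: "nat \<Rightarrow> real"
    and A11 :: "((real, 'r) vec, 'r) vec" and A21 :: "((real, 'r) vec, 's) vec"
    and B1 :: "(real^'m, 'r) vec" and B2 :: "(real^'m, 's) vec"
    and C1 :: "(real, 'r) vec^'p"
    and \<Sigma>2 :: "((real, 's) vec, 's) vec"
    and Pg :: "(real, 'r) vec^('r + 's)" and Pg2 :: "((real, 'r) vec, 's) vec"
    and x :: "real \<Rightarrow> 'w \<Rightarrow> real^('r + 's)" and xr :: "real \<Rightarrow> 'w \<Rightarrow> (real, 'r) vec"
    and y yBT :: "real \<Rightarrow> 'w \<Rightarrow> real^'p"
    and \<tau> :: real
  assumes "prob_space \<Omega>"
    and "levy_process \<Omega> M"
    and "square_integrable_process \<Omega> M"
    and "mean_zero_process \<Omega> M"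
    and "QM = covariance_at_one \<Omega> M"
    and "asymptotically_stable A"
    and "P = reachability_gramian A B QM"
    and "Q = observability_gramian A C"
    and "positive_definite P"
    and "positive_definite Q"
    and "hankel_singular_values P Q \<sigma>"
    and "\<sigma> CARD('r) \<noteq> \<sigma> (CARD('r) + 1)"
    and "\<Sigma> = hankel_matrix \<sigma>"
    and "balancing_transformation P Q \<sigma> T"
    and "A11 = upper_rows (left_columns (T ** A ** matrix_inv T))"
    and "A21 = lower_rows (left_columns (T ** A ** matrix_inv T))"
    and "B1 = upper_rows (T ** B)"
    and "B2 = lower_rows (T ** B)"
    and "C1 = left_columns (C ** matrix_inv T)"
    and "\<Sigma>2 = lower_rows (right_columns \<Sigma>)"
    and "linear_sde_solution \<Omega> A B M x"
    and "\<And>t \<omega>. y t \<omega> = C *v x t \<omega>"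
    and "linear_sde_solution \<Omega> A11 B1 M xr"
    and "\<And>t \<omega>. yBT t \<omega> = C1 *v xr t \<omega>"
    and "A ** Pg + Pg ** transpose A11 = - (B ** QM ** transpose B1)"
    and "Pg2 = lower_rows (T ** Pg)"
    and "\<tau> > 0"
  shows "(SUP t\<in>{0..\<tau>}. \<integral>\<^sup>+\<omega>. ennreal (norm (y t \<omega> - yBT t \<omega>)) \<partial>\<Omega>)
    \<le> ennreal (sqrt (trace (\<Sigma>2 ** (B2 ** QM ** transpose B2 + 2 *\<^sub>R (Pg2 ** transpose A21)))))"
proof -
  interpret prob_space \<Omega> by fact
  note L = assms(2-5)
  have QM_sym: "transpose QM = QM" by (rule covariance_symmetric[OF L])
  have QM_psd: "0 \<le> v \<bullet> (QM *v v)" for v by (rule covariance_psd[OF L])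
  have P: "x \<bullet> (P *v x) > 0" if "x \<noteq> 0" for x using assms(9) that by (simp add: positive_definite_def)
  have Q: "x \<bullet> (Q *v x) > 0" if "x \<noteq> 0" for x using assms(10) that by (simp add: positive_definite_def)
  have axis: "axis undefined 1 \<noteq> (0 :: real^('r + 's))" by (simp add: axis_eq_0_iff)
  \<comment> \<open>Both Gramians converge: the integral of a non-integrable function is \<open>0\<close> by convention, and \<open>0\<close> is
    not positive definite.\<close>
  have "((\<lambda>s. matrix_exp (s *\<^sub>R A) ** B ** QM ** transpose B ** matrix_exp (s *\<^sub>R transpose A)) has_integral P) {0..}"
  proof -
    have "P \<noteq> 0" using P[OF axis] by auto
    then show ?thesis
      using assms(7) not_integrable_integral unfolding reachability_gramian_def
      by (metis (no_types, lifting) integrable_integral)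
  qed
  then have P_int: "((\<lambda>s. matrix_exp (s *\<^sub>R A) ** (B ** QM ** transpose B) ** transpose (matrix_exp (s *\<^sub>R A))) has_integral P) {0..}"
    by (simp add: transpose_matrix_exp matrix_mul_assoc)
  have "((\<lambda>s. matrix_exp (s *\<^sub>R transpose A) ** transpose C ** C ** matrix_exp (s *\<^sub>R A)) has_integral Q) {0..}"
  proof -
    have "Q \<noteq> 0" using Q[OF axis] by auto
    then show ?thesis
      using assms(8) not_integrable_integral unfolding observability_gramian_def
      by (metis (no_types, lifting) integrable_integral)
  qed
  then have Q_int: "((\<lambda>s. matrix_exp (s *\<^sub>R transpose A) ** (transpose C ** C) ** transpose (matrix_exp (s *\<^sub>R transpose A))) has_integral Q) {0..}"
    by (simp add: transpose_matrix_exp matrix_mul_assoc)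
  note lyapP = lyapunov_equation_of_integral[OF P_int]
  have lyapQ: "transpose A ** Q + Q ** A = - (transpose C ** C)"
    using lyapunov_equation_of_integral(1)[OF Q_int] by simp
  have stable: "((\<lambda>t. matrix_exp (t *\<^sub>R A)) \<longlongrightarrow> 0) at_top"
    by (rule tendsto_zero_of_congruence[OF P lyapP(2)])

  have \<sigma>_pos: "\<sigma> k > 0" if "k \<in> {1..CARD('r + 's)}" for k
    by (rule hankel_singular_value_pos[OF assms(9,10,11) that])
  have TP: "T ** P ** transpose T = \<Sigma>" and TQ: "transpose T ** \<Sigma> ** T = Q"
    using balancing_transformation_balances[OF \<sigma>_pos assms(14)] assms(13) by auto
  have "invertible T"
    unfolding invertible_left_inverse matrix_left_invertible_ker
  proof (intro allI impI)
    fix x assume "T *v x = 0"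
    then have "Q *v x = 0"
      by (simp flip: TQ matrix_vector_mul_assoc)
    then show "x = 0" using Q[of x] by (cases "x = 0") auto
  qed
  then have "T ** matrix_inv T = mat 1 \<and> matrix_inv T ** T = mat 1"
    unfolding invertible_def matrix_inv_def by (rule someI_ex)
  then obtain R where R: "R = matrix_inv T" "T ** R = mat 1" "R ** T = mat 1" by blast
  have RT: "transpose R ** transpose T = mat 1" "transpose T ** transpose R = mat 1"
    using R(2,3) by (metis matrix_transpose_mul transpose_mat)+
  define Ab where "Ab = T ** A ** R"
  define Bb where "Bb = T ** B"
  define Cb where "Cb = C ** R"
  define Pb where "Pb = T ** Pg"
  have RTX: "R ** (T ** X) = X" for X :: "real^'k^('r + 's)" by (simp add: matrix_mul_assoc R(2,3))
  have RTX': "transpose R ** (transpose T ** X) = X" for X :: "real^'k^('r + 's)"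
    by (simp add: matrix_mul_assoc RT)
  have TRX': "transpose T ** (transpose R ** X) = X" for X :: "real^'k^('r + 's)"
    by (simp add: matrix_mul_assoc RT)
  have reach: "Ab ** \<Sigma> + \<Sigma> ** transpose Ab = - (Bb ** QM ** transpose Bb)"
  proof -
    have "Ab ** \<Sigma> + \<Sigma> ** transpose Ab = T ** (A ** P + P ** transpose A) ** transpose T"
      by (simp add: Ab_def TP[symmetric] matrix_transpose_mul matrix_mult_bilinear_simps
          matrix_mul_assoc[symmetric] RTX TRX')
    then show ?thesis
      by (simp add: lyapP(1) Bb_def matrix_transpose_mul matrix_mult_bilinear_simps matrix_mul_assoc)
  qed
  have obs: "transpose Ab ** \<Sigma> + \<Sigma> ** Ab = - (transpose Cb ** Cb)"
  proof -
    have S: "\<Sigma> = transpose R ** Q ** R"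
      by (simp add: TQ[symmetric] matrix_mul_assoc[symmetric] RTX' R(2))
    have "transpose Ab ** \<Sigma> + \<Sigma> ** Ab = transpose R ** (transpose A ** Q + Q ** A) ** R"
      by (simp add: Ab_def S matrix_transpose_mul matrix_mult_bilinear_simps
          matrix_mul_assoc[symmetric] RTX TRX')
    then show ?thesis
      by (simp add: lyapQ Cb_def matrix_transpose_mul matrix_mult_bilinear_simps matrix_mul_assoc)
  qed
  have off: "upper_rows (right_columns \<Sigma>) = 0" "lower_rows (left_columns \<Sigma>) = 0"
    unfolding assms(13) hankel_matrix_def
    by (simp_all add: upper_rows_def lower_rows_def left_columns_def right_columns_def diag_matrix_def vec_eq_iff)
  have sym: "transpose \<Sigma> = \<Sigma>" unfolding assms(13) hankel_matrix_def by (rule transpose_diag_matrix)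
  have blocks: "A11 = upper_rows (left_columns Ab)" "A21 = lower_rows (left_columns Ab)"
    "B1 = upper_rows Bb" "B2 = lower_rows Bb" "C1 = left_columns Cb" "Pg2 = lower_rows Pb"
    using assms(15-19,26) by (simp_all add: Ab_def Bb_def Cb_def Pb_def R(1))
  have cross: "Ab ** Pb + Pb ** transpose A11 = - (Bb ** QM ** transpose B1)"
  proof -
    have "Ab ** Pb + Pb ** transpose A11 = T ** (A ** Pg + Pg ** transpose A11)"
      by (simp add: Ab_def Pb_def matrix_mult_bilinear_simps matrix_mul_assoc[symmetric] RTX)
    then show ?thesis by (simp add: assms(25) Bb_def matrix_mult_bilinear_simps matrix_mul_assoc)
  qed
  define \<Sigma>1 where "\<Sigma>1 = upper_rows (left_columns \<Sigma>)"
  define K where "K = trace (\<Sigma>2 ** (B2 ** QM ** transpose B2 + 2 *\<^sub>R (Pg2 ** transpose A21)))"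
  have P_eq: "C ** P ** transpose C = Cb ** \<Sigma> ** transpose Cb"
    by (simp add: Cb_def TP[symmetric] matrix_transpose_mul matrix_mul_assoc[symmetric] RTX TRX')
  have Pg_eq: "C ** Pg = Cb ** Pb"
    by (simp add: Cb_def Pb_def matrix_mul_assoc[symmetric] RTX)
  have K_eq: "trace (C ** P ** transpose C) + trace (C1 ** \<Sigma>1 ** transpose C1)
      - 2 * trace (C ** Pg ** transpose C1) = K"
    unfolding P_eq Pg_eq K_def \<Sigma>1_def assms(20)
    using balanced_truncation_trace_identity[OF reach obs off sym cross[unfolded blocks]]
    by (simp only: blocks)
  have reach1: "A11 ** \<Sigma>1 + \<Sigma>1 ** transpose A11 = - (B1 ** QM ** transpose B1)"
    unfolding blocks \<Sigma>1_def by (rule truncated_reachability_equation[OF reach obs off])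
  have \<Sigma>1_diag: "\<Sigma>1 = diag_matrix (\<lambda>i. \<sigma> (coord_number (Inl i :: 'r + 's)))"
    unfolding \<Sigma>1_def assms(13) hankel_matrix_def
    by (simp add: upper_rows_def left_columns_def diag_matrix_def vec_eq_iff)
  have \<Sigma>1_pos: "0 < v \<bullet> (\<Sigma>1 *v v)" if v: "v \<noteq> 0" for v
  proof -
    have s: "\<sigma> (coord_number (Inl i :: 'r + 's)) > 0" for i
      by (intro \<sigma>_pos coord_number_range)
    obtain i where "v $ i \<noteq> 0" using v by (auto simp: vec_eq_iff)
    then show ?thesis
      unfolding \<Sigma>1_diag diag_matrix_quadratic_form
      by (intro sum_pos2[of _ i] mult_pos_pos mult_nonneg_nonneg s less_imp_le[OF s]) auto
  qed
  define F where "F s = C ** matrix_exp (s *\<^sub>R A) ** B - C1 ** matrix_exp (s *\<^sub>R A11) ** B1" for s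
  show ?thesis
    unfolding K_def[symmetric]
  proof (rule SUP_least)
    fix t assume "t \<in> {0..\<tau>}"
    then have t: "t \<ge> 0" by simp
    define I where "I = integral {0..t} (\<lambda>s. trace (F s ** QM ** transpose (F s)))"
    have I_le: "I \<le> K"
      unfolding I_def F_def K_eq[symmetric]
      by (rule output_error_energy_le[OF QM_sym QM_psd lyapP(1) assms(25) reach1 \<Sigma>1_pos stable t])
    have "0 \<le> I"
      unfolding I_def trace_congruence
      by (cases "(\<lambda>s. \<Sum>i\<in>UNIV. F s $ i \<bullet> (QM *v (F s $ i))) integrable_on {0..t}")
         (auto intro!: Henstock_Kurzweil_Integration.integral_nonneg sum_nonneg QM_psd simp: not_integrable_integral)
    then have K0: "0 \<le> K" using I_le by simp
    have meas: "x t \<in> borel_measurable \<Omega>" "xr t \<in> borel_measurable \<Omega>"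
      using assms(21,23) t by (simp_all add: linear_sde_solution_def)
    have "(\<lambda>\<omega>. norm (y t \<omega> - yBT t \<omega>)) \<in> borel_measurable \<Omega>"
      unfolding assms(22,24)
      by (intro measurable_compose[OF _ borel_measurable_norm] borel_measurable_diff
          borel_measurable_matrix_vector_mult meas)
    moreover have "(\<integral>\<^sup>+\<omega>. ennreal ((norm (y t \<omega> - yBT t \<omega>))\<^sup>2) \<partial>\<Omega>) \<le> ennreal K"
    proof -
      have "(\<integral>\<^sup>+\<omega>. ennreal ((norm (y t \<omega> - yBT t \<omega>))\<^sup>2) \<partial>\<Omega>) \<le> ennreal I"
        unfolding assms(22,24) I_def F_def
        by (rule output_difference_second_moment_le[OF L assms(21,23) t])
      also have "\<dots> \<le> ennreal K" by (rule ennreal_leI[OF I_le])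
      finally show ?thesis .
    qed
    ultimately show "(\<integral>\<^sup>+\<omega>. ennreal (norm (y t \<omega> - yBT t \<omega>)) \<partial>\<Omega>) \<le> ennreal (sqrt K)"
      by (intro nn_integral_le_sqrt_second_moment K0) auto
  qed
qed

end
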